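(* Let $d\ge1$, and let $s>1$ be sufficiently large. Let $\rho_0\in H^s(\mathbb{T}^d)\cap\mathcal{P}(\mathbb{T}^d)$ with $\rho_0>0$, and let $u_0=\nabla U_0\in H^s(\mathbb{T}^d)$ for a real-valued function $U_0$ on $\mathbb{T}^d$. Let $V_0=\log\rho_0$ and, for $\hbar>0$ and $\varepsilon>0$ (small enough that $e^{V_0}-\varepsilon\Delta V_0>0$), set $$\psi^{\mathrm{in}}_{\varepsilon,\hbar}(x):=\sqrt{e^{V_0(x)}-\varepsilon\Delta V_0(x)}\;e^{\frac{iU_0(x)}{\hbar}}.$$ Then, for this choice of $\psi^{\mathrm{in}}_{\varepsilon,\hbar}$, the modulated energy at time $0$ satisfies $\mathcal{E}_{\varepsilon,\hbar}(0)\to0$ as $\varepsilon+\hbar\to0$.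
   Context: $\mathbb{T}^d$ is the flat unit-volume torus and $\mathcal{P}(\mathbb{T}^d)$ the probability measures on it. The modulated energy at time $0$ associated with the initial wave function $\psi^{\mathrm{in}}_{\varepsilon,\hbar}$ and the initial fluid data $(\rho_0,u_0)$ is $$\mathcal{E}_{\varepsilon,\hbar}(0):=\frac12\int_{\mathbb{T}^d}|(i\hbar\nabla+u_0)\psi^{\mathrm{in}}_{\varepsilon,\hbar}|^2dx+\frac\varepsilon2\int_{\mathbb{T}^d}|\nabla V|^2dx+\int_{\mathbb{T}^d}\Big(m\log\frac{m}{\rho_0}-m+\rho_0\Big)dx,$$ where $V=V_{\varepsilon,\hbar}(0,\cdot)$ is the unique solution of the Poisson-Boltzmann equation $-\varepsilon\Delta V=|\psi^{\mathrm{in}}_{\varepsilon,\hbar}|^2-e^V$ on $\mathbb{T}^d$ and $m=e^V$. *)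

theory Defs
  imports "HOL-Probability.Probability"
begin

text \<open>
  Functions on the flat torus of dimension \<^term>\<open>CARD('n)\<close> are functions on \<^typ>\<open>real^'n\<close> with
  period 1 in each coordinate.  The normalised measure of the torus is Lebesgue measure on the
  closed unit cube, a fundamental domain up to a null set.
\<close>

definition periodic_fun :: "(real^'n \<Rightarrow> 'b) \<Rightarrow> bool" where
  "periodic_fun f \<longleftrightarrow> (\<forall>x i. f (x + axis i 1) = f x)"

definition torus_measure :: "(real^'n) measure" where
  "torus_measure = restrict_space lebesgue (cbox 0 1)"

definition pderiv_dir :: "'n \<Rightarrow> (real^'n \<Rightarrow> 'b::real_normed_vector) \<Rightarrow> real^'n \<Rightarrow> 'b" where
  "pderiv_dir i f x = vector_derivative (\<lambda>t. f (x + t *\<^sub>R axis i 1)) (at 0)"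

definition grad :: "(real^'n \<Rightarrow> real) \<Rightarrow> real^'n \<Rightarrow> real^'n" where
  "grad f x = (\<chi> i. pderiv_dir i f x)"

definition laplacian :: "(real^'n \<Rightarrow> real) \<Rightarrow> real^'n \<Rightarrow> real" where
  "laplacian f x = (\<Sum>i\<in>UNIV. pderiv_dir i (pderiv_dir i f) x)"

primrec torus_C :: "nat \<Rightarrow> (real^'n \<Rightarrow> 'b::real_normed_vector) \<Rightarrow> bool" where
  "torus_C 0 f \<longleftrightarrow> periodic_fun f \<and> continuous_on UNIV f"
| "torus_C (Suc k) f \<longleftrightarrow> periodic_fun f \<and> continuous_on UNIV f \<and>
     (\<forall>i. (\<forall>x. (\<lambda>t. f (x + t *\<^sub>R axis i 1)) differentiable (at 0)) \<and> torus_C k (pderiv_dir i f))"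

definition fourier_coeff :: "(real^'n \<Rightarrow> real) \<Rightarrow> int^'n \<Rightarrow> complex" where
  "fourier_coeff f k =
     (LINT x|torus_measure. of_real (f x) * exp (- 2 * of_real pi * \<i> * of_real (\<Sum>i\<in>UNIV. of_int (k $ i) * x $ i)))"

text \<open>The Sobolev space \<open>H\<^sup>s\<close> of the torus.  A member is a square-integrable function, not an
  equivalence class, so continuity of the representative has to be required separately.\<close>

definition torus_sobolev :: "real \<Rightarrow> (real^'n \<Rightarrow> real) \<Rightarrow> bool" where
  "torus_sobolev s f \<longleftrightarrow>
     periodic_fun f \<and> f \<in> borel_measurable torus_measure \<and>
     integrable torus_measure (\<lambda>x. (f x)\<^sup>2) \<and>
     (\<lambda>k::int^'n. (1 + (\<Sum>i\<in>UNIV. (of_int (k $ i))\<^sup>2)) powr s * (cmod (fourier_coeff f k))\<^sup>2)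
       summable_on UNIV"

definition torus_prob_density :: "(real^'n \<Rightarrow> real) \<Rightarrow> bool" where
  "torus_prob_density \<rho> \<longleftrightarrow>
     periodic_fun \<rho> \<and> \<rho> \<in> borel_measurable torus_measure \<and> (\<forall>x. 0 \<le> \<rho> x) \<and>
     prob_space (density torus_measure (\<lambda>x. ennreal (\<rho> x)))"

text \<open>Classical solutions of the Poisson-Boltzmann equation for \<open>\<epsilon> > 0\<close>; these are unique by the
  maximum principle, so the definite description below is meaningful whenever one exists.\<close>

definition PB_solution :: "real \<Rightarrow> (real^'n \<Rightarrow> complex) \<Rightarrow> (real^'n \<Rightarrow> real) \<Rightarrow> bool" where
  "PB_solution \<epsilon> \<psi> V \<longleftrightarrow>
     torus_C 2 V \<and> (\<forall>x. - \<epsilon> * laplacian V x = (cmod (\<psi> x))\<^sup>2 - exp (V x))"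

definition PB_potential :: "real \<Rightarrow> (real^'n \<Rightarrow> complex) \<Rightarrow> real^'n \<Rightarrow> real" where
  "PB_potential \<epsilon> \<psi> = (THE V. PB_solution \<epsilon> \<psi> V)"

definition modulated_energy ::
  "real \<Rightarrow> real \<Rightarrow> (real^'n \<Rightarrow> complex) \<Rightarrow> (real^'n \<Rightarrow> real) \<Rightarrow> (real^'n \<Rightarrow> real^'n) \<Rightarrow> real" where
  "modulated_energy \<epsilon> hbar \<psi> \<rho>\<^sub>0 u\<^sub>0 =
     (let V = PB_potential \<epsilon> \<psi>; m = (\<lambda>x. exp (V x)) in
        1 / 2 * (LINT x|torus_measure.
          (norm (\<chi> i. \<i> * of_real hbar * pderiv_dir i \<psi> x + of_real (u\<^sub>0 x $ i) * \<psi> x))\<^sup>2)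
        + \<epsilon> / 2 * (LINT x|torus_measure. (norm (grad V x))\<^sup>2)
        + (LINT x|torus_measure. m x * ln (m x / \<rho>\<^sub>0 x) - m x + \<rho>\<^sub>0 x))"

definition psi_in ::
  "real \<Rightarrow> real \<Rightarrow> (real^'n \<Rightarrow> real) \<Rightarrow> (real^'n \<Rightarrow> real) \<Rightarrow> real^'n \<Rightarrow> complex" where
  "psi_in \<epsilon> hbar V\<^sub>0 U\<^sub>0 x =
     of_real (sqrt (exp (V\<^sub>0 x) - \<epsilon> * laplacian V\<^sub>0 x)) * exp (\<i> * of_real (U\<^sub>0 x) / of_real hbar)"

end

theory Submission
  imports Defs
begin

text \<open>
  The initial wave function is prepared so that its potential is known.  Its density
  \<open>\<bar>\<psi>\<bar>\<^sup>2 = exp V\<^sub>0 - \<epsilon> \<Delta>V\<^sub>0\<close> makes \<open>V\<^sub>0 = ln \<rho>\<^sub>0\<close> itself a solution of the Poisson-Boltzmann equation, and the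
  maximum principle (\<open>PB_solution_le\<close>) says that it is the only one.  Hence \<open>m = \<rho>\<^sub>0\<close> and the relative entropy is
  zero, while the electric energy is \<open>\<epsilon>\<close> times a constant.  Its phase \<open>U\<^sub>0 / hbar\<close> makes the
  velocity term cancel the derivative of the phase (\<open>kinetic_density_psi_in\<close>), so that the kinetic energy is
  \<open>hbar\<^sup>2 / 2\<close> times the Dirichlet integral of \<open>\<surd>f\<close> with \<open>f = \<rho>\<^sub>0 - \<epsilon> \<Delta>V\<^sub>0\<close>.  As \<open>\<rho>\<^sub>0\<close> is bounded below by a positive
  constant, that integral is bounded for small \<open>\<epsilon>\<close>, and the modulated energy is
  \<open>O(hbar\<^sup>2 + \<epsilon>)\<close> (\<open>modulated_energy_bound\<close>).

  The estimate needs bounded derivatives of \<open>\<Delta>V\<^sub>0\<close>, that is, three continuous derivatives of \<open>\<rho>\<^sub>0\<close>.  They come from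
  the Sobolev hypothesis for large \<open>s\<close> (\<open>sobolev_embedding\<close>): the Fourier coefficients of \<open>\<rho>\<^sub>0\<close>, multiplied by
  a power of the frequency, are absolutely summable, so the Fourier series may be differentiated term by
  term (\<open>torus_C_fourier_series\<close>).  The series represents \<open>\<rho>\<^sub>0\<close> because a continuous periodic
  function with vanishing Fourier coefficients is zero; this is proved by integrating
  against trigonometric polynomials that concentrate at a point (\<open>nonpos_of_orthogonal_trig_poly\<close>).
\<close>

section \<open>Differential calculus of periodic functions\<close>

lemma pderiv_dirI:
  assumes "((\<lambda>t. f (x + t *\<^sub>R axis i 1)) has_vector_derivative D) (at 0)"
  shows "pderiv_dir i f x = D"
  unfolding pderiv_dir_def using assms by (rule vector_derivative_at)

text \<open>
  Exhibiting candidate partial derivatives \<open>D i\<close> is enough: the vector derivative is unique, so they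
  coincide with \<open>pderiv_dir\<close>.  The closure properties of \<open>torus_C\<close> below rest on this rule.
\<close>

lemma torus_C_SucI:
  assumes "periodic_fun f" "continuous_on UNIV f"
    and "\<And>i x. ((\<lambda>t. f (x + t *\<^sub>R axis i 1)) has_vector_derivative D i x) (at 0)"
    and "\<And>i. torus_C k (D i)"
  shows "torus_C (Suc k) f"
proof -
  have "pderiv_dir i f = D i" for i
    using pderiv_dirI[OF assms(3)] by blast
  then show ?thesis
    using assms by (auto intro: differentiableI_vector)
qed

lemma torus_C_periodic: "torus_C k f \<Longrightarrow> periodic_fun f"
  by (cases k) auto

lemma torus_C_continuous: "torus_C k f \<Longrightarrow> continuous_on UNIV f"
  by (cases k) auto

lemma torus_C_pderiv: "torus_C (Suc k) f \<Longrightarrow> torus_C k (pderiv_dir i f)"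
  by simp

lemma torus_C_has_pderiv:
  assumes "torus_C (Suc k) f"
  shows "((\<lambda>t. f (x + t *\<^sub>R axis i 1)) has_vector_derivative pderiv_dir i f x) (at 0)"
  using assms by (auto simp: pderiv_dir_def vector_derivative_works)

lemma torus_C_has_pderiv_real:
  fixes f :: "real^'n \<Rightarrow> real"
  assumes "torus_C (Suc k) f"
  shows "((\<lambda>t. f (x + t *\<^sub>R axis i 1)) has_real_derivative pderiv_dir i f x) (at 0)"
  using torus_C_has_pderiv[OF assms] by (simp add: has_real_derivative_iff_has_vector_derivative)

lemma torus_C_mono: "torus_C m f \<Longrightarrow> k \<le> m \<Longrightarrow> torus_C k f"
proof (induction m arbitrary: k f)
  case (Suc m)
  show ?case
  proof (cases k)
    case 0
    then show ?thesis using Suc.prems by simp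
  next
    case (Suc k')
    then show ?thesis using Suc.prems Suc.IH[of _ k'] by simp
  qed
qed simp

lemma torus_C_const: "torus_C k (\<lambda>x. c)"
proof (induction k arbitrary: c)
  case (Suc k)
  show ?case
    by (rule torus_C_SucI[where D = "\<lambda>i x. 0"]) (auto simp: periodic_fun_def Suc)
qed (auto simp: periodic_fun_def)

lemma torus_C_add:
  assumes "torus_C k f" "torus_C k g"
  shows "torus_C k (\<lambda>x. f x + g x)"
  using assms
proof (induction k arbitrary: f g)
  case (Suc k)
  show ?case
  proof (rule torus_C_SucI)
    show "((\<lambda>t. f (x + t *\<^sub>R axis i 1) + g (x + t *\<^sub>R axis i 1)) has_vector_derivative
       pderiv_dir i f x + pderiv_dir i g x) (at 0)" for i x
      by (intro has_vector_derivative_add torus_C_has_pderiv[OF Suc.prems(1)] torus_C_has_pderiv[OF Suc.prems(2)])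
    show "torus_C k (\<lambda>x. pderiv_dir i f x + pderiv_dir i g x)" for i
      by (intro Suc.IH torus_C_pderiv Suc.prems)
  qed (use Suc.prems in \<open>auto simp: periodic_fun_def intro!: continuous_intros\<close>)
qed (auto simp: periodic_fun_def intro!: continuous_intros)

lemma torus_C_mult:
  fixes f g :: "real^'n \<Rightarrow> real"
  assumes "torus_C k f" "torus_C k g"
  shows "torus_C k (\<lambda>x. f x * g x)"
  using assms
proof (induction k arbitrary: f g)
  case (Suc k)
  show ?case
  proof (rule torus_C_SucI)
    show "((\<lambda>t. f (x + t *\<^sub>R axis i 1) * g (x + t *\<^sub>R axis i 1)) has_vector_derivative
       pderiv_dir i f x * g x + f x * pderiv_dir i g x) (at 0)" for i x
      unfolding has_real_derivative_iff_has_vector_derivative[symmetric]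
      by (rule derivative_eq_intros torus_C_has_pderiv_real[OF Suc.prems(1)]
            torus_C_has_pderiv_real[OF Suc.prems(2)] refl)+ auto
    show "torus_C k (\<lambda>x. pderiv_dir i f x * g x + f x * pderiv_dir i g x)" for i
      using Suc.prems by (intro torus_C_add Suc.IH torus_C_pderiv) (auto intro: torus_C_mono[where m = "Suc k"])
  qed (use Suc.prems in \<open>auto simp: periodic_fun_def intro!: continuous_intros\<close>)
qed (auto simp: periodic_fun_def intro!: continuous_intros)

lemma torus_C_sum:
  "finite A \<Longrightarrow> (\<And>a. a \<in> A \<Longrightarrow> torus_C k (f a)) \<Longrightarrow> torus_C k (\<lambda>x. \<Sum>a\<in>A. f a x)"
  by (induction A rule: finite_induct) (auto intro: torus_C_const torus_C_add)

text \<open>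
  By induction on the order: the derivative \<open>- \<partial>f \<cdot> f\<inverse> \<cdot> f\<inverse>\<close> involves \<open>f\<inverse>\<close> undifferentiated only, so
  it has one order of smoothness less by the induction hypothesis.
\<close>

lemma torus_C_inverse:
  fixes f :: "real^'n \<Rightarrow> real"
  assumes "torus_C k f" "\<And>x. f x \<noteq> 0"
  shows "torus_C k (\<lambda>x. inverse (f x))"
  using assms(1)
proof (induction k)
  case (Suc k)
  show ?case
  proof (rule torus_C_SucI)
    show "((\<lambda>t. inverse (f (x + t *\<^sub>R axis i 1))) has_vector_derivative
       - 1 * (pderiv_dir i f x * (inverse (f x) * inverse (f x)))) (at 0)" for i x
      unfolding has_real_derivative_iff_has_vector_derivative[symmetric]
      by (rule derivative_eq_intros torus_C_has_pderiv_real[OF Suc.prems] refl)+ (auto simp: assms(2))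
    show "torus_C k (\<lambda>x. - 1 * (pderiv_dir i f x * (inverse (f x) * inverse (f x))))" for i
      using Suc.prems
      by (intro torus_C_mult torus_C_const Suc.IH torus_C_pderiv) (auto intro: torus_C_mono[where m = "Suc k"])
  qed (use Suc.prems assms(2) in \<open>auto simp: periodic_fun_def intro!: continuous_intros\<close>)
qed (use assms(2) in \<open>auto simp: periodic_fun_def intro!: continuous_intros\<close>)

text \<open>
  The logarithm disappears after one differentiation, \<open>\<partial> ln f = \<partial>f \<cdot> f\<inverse>\<close>, and the result on \<open>f\<inverse>\<close> takes over.
\<close>

lemma torus_C_ln:
  fixes f :: "real^'n \<Rightarrow> real"
  assumes "torus_C k f" "\<And>x. f x > 0"
  shows "torus_C k (\<lambda>x. ln (f x))"
proof (cases k)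
  case 0
  then show ?thesis
    using assms by (auto simp: periodic_fun_def less_imp_neq[THEN not_sym] intro!: continuous_intros)
next
  case (Suc k')
  have f: "torus_C (Suc k') f" using assms(1) Suc by simp
  have nz: "f x \<noteq> 0" for x using assms(2)[of x] by simp
  have "torus_C (Suc k') (\<lambda>x. ln (f x))"
  proof (rule torus_C_SucI)
    show "((\<lambda>t. ln (f (x + t *\<^sub>R axis i 1))) has_vector_derivative
       pderiv_dir i f x * inverse (f x)) (at 0)" for i x
      unfolding has_real_derivative_iff_has_vector_derivative[symmetric]
      by (auto intro!: derivative_eq_intros torus_C_has_pderiv_real[OF f] simp: assms(2) divide_inverse)
    show "torus_C k' (\<lambda>x. pderiv_dir i f x * inverse (f x))" for i
      using nz by (intro torus_C_mult torus_C_inverse torus_C_pderiv f torus_C_mono[OF f]) auto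
  qed (use f nz in \<open>auto simp: periodic_fun_def intro!: continuous_intros\<close>)
  then show ?thesis using Suc by simp
qed

lemma torus_C_laplacian:
  assumes "torus_C (Suc (Suc k)) f"
  shows "torus_C k (laplacian f)"
  unfolding laplacian_def[abs_def]
  using assms by (intro torus_C_sum torus_C_pderiv) auto

lemma periodic_fun_int_shift:
  assumes "periodic_fun f"
  shows "f (x + (\<chi> i. of_int (n i))) = f x"
proof -
  have nat: "f (y + of_nat k *\<^sub>R axis i 1) = f y" for y i and k :: nat
  proof (induction k)
    case (Suc k)
    have "f (y + of_nat (Suc k) *\<^sub>R axis i 1) = f ((y + of_nat k *\<^sub>R axis i 1) + axis i 1)"
      by (simp add: algebra_simps)
    then show ?case using assms Suc by (simp add: periodic_fun_def)
  qed simp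
  have int: "f (y + of_int k *\<^sub>R axis i 1) = f y" for y i and k :: int
  proof (cases k rule: int_cases2)
    case (nonpos m)
    then show ?thesis
      using nat[of "y + of_int k *\<^sub>R axis i 1" m i] by simp
  qed (use nat in simp)
  have "f (y + (\<Sum>i\<in>A. of_int (n i) *\<^sub>R axis i 1)) = f y" if "finite A" for A y
    using that
  proof (induction A arbitrary: y)
    case (insert a A)
    have "f (y + (\<Sum>i\<in>insert a A. of_int (n i) *\<^sub>R axis i 1)) =
        f ((y + of_int (n a) *\<^sub>R axis a 1) + (\<Sum>i\<in>A. of_int (n i) *\<^sub>R axis i 1))"
      using insert by (simp add: add.assoc)
    then show ?case using insert.IH int by metis
  qed simp
  moreover have "(\<chi> i. of_int (n i)) = (\<Sum>i\<in>UNIV. of_int (n i) *\<^sub>R axis i 1 :: real^'a)"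
    by (simp add: vec_eq_iff axis_def if_distrib cong: if_cong)
  ultimately show ?thesis by simp
qed

text \<open>
  Subtracting the integer parts of the coordinates moves any point into the unit cube; this makes
  compactness available for periodic functions.
\<close>

lemma periodic_fun_unit_cube:
  assumes "periodic_fun f"
  obtains y where "y \<in> cbox 0 1" "f y = f (x :: real^'n)"
proof
  show "x + (\<chi> i. of_int (- \<lfloor>x $ i\<rfloor>)) \<in> cbox 0 1"
    by (auto simp: mem_box_cart) linarith
  show "f (x + (\<chi> i. of_int (- \<lfloor>x $ i\<rfloor>))) = f x"
    by (rule periodic_fun_int_shift[OF assms])
qed

lemma periodic_attains_sup:
  fixes f :: "real^'n \<Rightarrow> real"
  assumes "periodic_fun f" "continuous_on UNIV f"
  obtains x0 where "\<And>x. f x \<le> f x0"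
proof -
  have "continuous_on (cbox 0 1) f" using assms(2) by (rule continuous_on_subset) simp
  moreover have "(0::real^'n) \<in> cbox 0 1" by (simp add: mem_box_cart)
  ultimately obtain x0 where x0: "\<forall>y\<in>cbox 0 1. f y \<le> f x0"
    using continuous_attains_sup[OF compact_cbox, of 0 1 f] by blast
  show ?thesis
    by (metis x0 periodic_fun_unit_cube[OF assms(1)] that)
qed

lemma periodic_bounded:
  fixes f :: "real^'n \<Rightarrow> 'b::real_normed_vector"
  assumes "periodic_fun f" "continuous_on UNIV f"
  obtains B where "B > 0" "\<And>x. norm (f x) \<le> B"
proof -
  have "periodic_fun (\<lambda>x. norm (f x))" "continuous_on UNIV (\<lambda>x. norm (f x))"
    using assms by (auto simp: periodic_fun_def intro!: continuous_intros)
  then obtain x0 where "\<And>x. norm (f x) \<le> norm (f x0)"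
    using periodic_attains_sup by blast
  then show ?thesis by (intro that[of "norm (f x0) + 1"]) (auto intro: add_nonneg_pos add_increasing2)
qed


section \<open>Uniqueness for the Poisson-Boltzmann equation\<close>

text \<open>
  If \<open>D\<close> were positive then \<open>g'\<close>, which vanishes at the maximum, would be positive just to the right
  of 0 and \<open>g\<close> would increase there.
\<close>

lemma second_derivative_at_maximum:
  fixes g :: "real \<Rightarrow> real"
  assumes g: "\<And>t. (g has_real_derivative g' t) (at t)"
    and g': "(g' has_real_derivative D) (at 0)"
    and max: "\<And>t. g t \<le> g 0"
  shows "D \<le> 0"
proof (rule ccontr)
  assume "\<not> D \<le> 0"
  then obtain d where d: "d > 0" and inc: "\<And>h. 0 < h \<Longrightarrow> h < d \<Longrightarrow> g' 0 < g' (0 + h)"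
    using DERIV_pos_inc_right[OF g'] by auto
  have "g' 0 = 0"
    using DERIV_local_max[OF g[of 0], of 1] max by auto
  moreover obtain z where "0 < z" "z < d / 2" "g (d / 2) - g 0 = (d / 2 - 0) * g' z"
    using MVT2[of 0 "d/2" g g'] g d by auto
  ultimately have "g (d / 2) > g 0"
    using inc[of z] d by (smt (verit) add_0 half_gt_zero mult_pos_pos field_sum_of_halves)
  with max show False by (simp add: not_less[symmetric])
qed

lemma laplacian_at_maximum:
  fixes f :: "real^'n \<Rightarrow> real"
  assumes f: "torus_C 2 f" and max: "\<And>x. f x \<le> f x0"
  shows "laplacian f x0 \<le> 0"
  unfolding laplacian_def
proof (rule sum_nonpos)
  fix i :: 'n
  have f': "torus_C (Suc (Suc 0)) f" using f by (simp add: numeral_2_eq_2)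
  let ?e = "axis i 1 :: real^'n"
  show "pderiv_dir i (pderiv_dir i f) x0 \<le> 0"
  proof (rule second_derivative_at_maximum)
    show "((\<lambda>t. f (x0 + t *\<^sub>R ?e)) has_real_derivative pderiv_dir i f (x0 + s *\<^sub>R ?e)) (at s)" for s
      using torus_C_has_pderiv_real[OF f', of "x0 + s *\<^sub>R ?e" i]
        DERIV_shift[of "\<lambda>t. f (x0 + t *\<^sub>R ?e)" _ 0 s]
      by (simp add: algebra_simps)
    show "((\<lambda>s. pderiv_dir i f (x0 + s *\<^sub>R ?e)) has_real_derivative pderiv_dir i (pderiv_dir i f) x0) (at 0)"
      using f' by (intro torus_C_has_pderiv_real torus_C_pderiv)
    show "f (x0 + t *\<^sub>R ?e) \<le> f (x0 + 0 *\<^sub>R ?e)" for t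
      using max by simp
  qed
qed

lemma laplacian_diff:
  fixes f g :: "real^'n \<Rightarrow> real"
  assumes "torus_C 2 f" "torus_C 2 g"
  shows "laplacian (\<lambda>x. f x - g x) x = laplacian f x - laplacian g x"
proof -
  have f: "torus_C (Suc (Suc 0)) f" and g: "torus_C (Suc (Suc 0)) g"
    using assms by (auto simp: numeral_2_eq_2)
  have 1: "pderiv_dir i (\<lambda>x. u x - v x) = (\<lambda>x. pderiv_dir i u x - pderiv_dir i v x)"
    if "torus_C (Suc k) u" "torus_C (Suc k) v" for i k and u v :: "real^'n \<Rightarrow> real"
    by (intro ext pderiv_dirI has_vector_derivative_diff torus_C_has_pderiv[OF that(1)] torus_C_has_pderiv[OF that(2)])
  show ?thesis
    unfolding laplacian_def 1[OF f g] 1[OF torus_C_pderiv[OF f] torus_C_pderiv[OF g]]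
    by (simp add: sum_subtractf)
qed

text \<open>
  Maximum principle.  At a maximum point of \<open>V - W\<close> the Laplacian of the difference is nonpositive,
  while the two equations identify \<open>\<epsilon> \<Delta>(V - W)\<close> with \<open>exp V - exp W\<close>.  Hence \<open>V \<le> W\<close> at that point, and
  so everywhere.  Exchanging the two solutions gives uniqueness.
\<close>

lemma PB_solution_le:
  assumes V: "PB_solution \<epsilon> \<psi> V" and W: "PB_solution \<epsilon> \<psi> W" and "\<epsilon> > 0"
  shows "V x \<le> W x"
proof -
  have C: "torus_C 2 V" "torus_C 2 W" using V W by (auto simp: PB_solution_def)
  then have D: "torus_C 2 (\<lambda>x. V x + - 1 * W x)"
    by (intro torus_C_add torus_C_mult torus_C_const)
  then have D: "torus_C 2 (\<lambda>x. V x - W x)" by simp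
  obtain x0 where x0: "\<And>x. V x - W x \<le> V x0 - W x0"
    using periodic_attains_sup[OF torus_C_periodic[OF D] torus_C_continuous[OF D]] by blast
  have "laplacian V x0 - laplacian W x0 \<le> 0"
    using laplacian_at_maximum[OF D x0] laplacian_diff[OF C] by simp
  moreover have "exp (V x0) - exp (W x0) = \<epsilon> * (laplacian V x0 - laplacian W x0)"
  proof -
    have "- \<epsilon> * laplacian V x0 = (cmod (\<psi> x0))\<^sup>2 - exp (V x0)"
      "- \<epsilon> * laplacian W x0 = (cmod (\<psi> x0))\<^sup>2 - exp (W x0)"
      using V W unfolding PB_solution_def by blast+
    then show ?thesis by (simp add: algebra_simps)
  qed
  ultimately have "exp (V x0) - exp (W x0) \<le> 0"
    using \<open>\<epsilon> > 0\<close> by (simp add: mult_nonneg_nonpos)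
  then show ?thesis using x0[of x] by simp
qed

lemma PB_potential_eq:
  assumes "PB_solution \<epsilon> \<psi> V" "\<epsilon> > 0"
  shows "PB_potential \<epsilon> \<psi> = V"
  unfolding PB_potential_def
  using assms by (intro the_equality) (auto intro!: ext antisym PB_solution_le)

section \<open>Integrals and characters on the torus\<close>

lemma prob_space_torus_measure: "prob_space (torus_measure :: (real^'n) measure)"
proof
  have "emeasure (torus_measure :: (real^'n) measure) (space torus_measure) = emeasure lebesgue (cbox 0 1 :: (real^'n) set)"
    by (simp add: torus_measure_def space_restrict_space emeasure_restrict_space)
  also have "\<dots> = emeasure lborel (cbox 0 1 :: (real^'n) set)"
    by simp
  also have "\<dots> = 1"
    by (subst emeasure_lborel_cbox) (auto simp: Basis_vec_def inner_axis prod.neutral)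
  finally show "emeasure (torus_measure :: (real^'n) measure) (space torus_measure) = 1" .
qed

text \<open>
  The torus has total mass 1.  A non-integrable \<open>g\<close> has integral 0 by convention, and \<open>B\<close> is nonnegative.
\<close>

lemma torus_integral_norm_le:
  fixes g :: "real^'n \<Rightarrow> 'b::{banach, second_countable_topology}"
  assumes "\<And>x. norm (g x) \<le> B"
  shows "norm (LINT x|torus_measure. g x) \<le> B"
proof (cases "integrable torus_measure g")
  case True
  interpret prob_space "torus_measure :: (real^'n) measure" by (rule prob_space_torus_measure)
  have "norm (LINT x|torus_measure. g x) \<le> (LINT x|torus_measure. norm (g x))"
    by (rule integral_norm_bound)
  also have "\<dots> \<le> B"
    by (rule integral_le_const) (use True assms in auto)
  finally show ?thesis .
next
  case False
  moreover have "0 \<le> B" using norm_ge_zero assms by (rule order_trans)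
  ultimately show ?thesis by (simp add: not_integrable_integral_eq)
qed


definition torus_char :: "int^'n \<Rightarrow> real^'n \<Rightarrow> complex" where
  "torus_char k x = exp (\<i> * of_real (2 * pi * (\<Sum>i\<in>UNIV. of_int (k $ i) * x $ i)))"

lemma torus_char_0 [simp]: "torus_char 0 x = 1"
  by (simp add: torus_char_def)

lemma torus_char_plus: "torus_char (k + l) x = torus_char k x * torus_char l x"
  by (simp add: torus_char_def exp_add[symmetric] sum.distrib distrib_left distrib_right)

lemma norm_torus_char [simp]: "norm (torus_char k x) = 1"
  unfolding torus_char_def by (rule norm_exp_i_times)

lemma continuous_torus_char [continuous_intros]: "continuous_on S (torus_char k)"
  unfolding torus_char_def[abs_def] by (intro continuous_intros)

lemma torus_char_shift:
  "torus_char k (x + t *\<^sub>R axis i 1) = torus_char k x * exp (\<i> * of_real (2 * pi * of_int (k $ i) * t))"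
proof -
  have "(\<Sum>j\<in>UNIV. of_int (k $ j) * (x + t *\<^sub>R axis i 1) $ j)
      = (\<Sum>j\<in>UNIV. of_int (k $ j) * x $ j) + (\<Sum>j\<in>UNIV. if j = i then of_int (k $ i) * t else 0)"
    unfolding sum.distrib[symmetric] by (rule sum.cong) (auto simp: axis_def algebra_simps)
  then have "(\<Sum>j\<in>UNIV. of_int (k $ j) * (x + t *\<^sub>R axis i 1) $ j)
      = (\<Sum>j\<in>UNIV. of_int (k $ j) * x $ j) + of_int (k $ i) * t"
    by simp
  then show ?thesis
    by (simp only: torus_char_def exp_add[symmetric]) (simp add: algebra_simps)
qed

lemma periodic_torus_char: "periodic_fun (torus_char (k :: int^'n))"
  unfolding periodic_fun_def
proof (intro allI)
  fix x :: "real^'n" and i :: 'n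
  have "exp (\<i> * of_real (2 * pi * of_int (k $ i) * 1)) = (1::complex)"
    by (rule exp_eq_1[THEN iffD2]) auto
  then show "torus_char k (x + axis i 1) = torus_char k x"
    using torus_char_shift[of k x 1 i] by simp
qed

lemma torus_integrable_continuous:
  fixes g :: "real^'n \<Rightarrow> 'b::{banach, second_countable_topology}"
  assumes "continuous_on UNIV g"
  shows "integrable torus_measure g"
    and "(LINT x|torus_measure. g x) = (LINT x|lborel. indicator (cbox 0 1) x *\<^sub>R g x)"
proof -
  let ?g = "\<lambda>x. indicator (cbox 0 1) x *\<^sub>R g x"
  have i: "integrable lborel ?g"
    using assms by (intro borel_integrable_compact continuous_on_subset[OF assms]) auto
  then have m: "?g \<in> borel_measurable lborel" by (rule borel_measurable_integrable)
  show "integrable torus_measure g"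
    unfolding torus_measure_def using i integrable_completion[OF m] by (simp add: integrable_restrict_space)
  show "(LINT x|torus_measure. g x) = (LINT x|lborel. ?g x)"
    unfolding torus_measure_def using integral_completion[OF m] by (simp add: integral_restrict_space)
qed

text \<open>
  Fubini for products of functions of single coordinates: Lebesgue measure on a Euclidean space is
  the image of a product of one-dimensional Lebesgue measures.
\<close>

lemma integral_lborel_prod:
  fixes f :: "'a::euclidean_space \<Rightarrow> real \<Rightarrow> complex"
  assumes int: "\<And>b. b \<in> Basis \<Longrightarrow> integrable lborel (f b)"
  shows "(LINT x|lborel. (\<Prod>b\<in>Basis. f b (x \<bullet> b))) = (\<Prod>b\<in>Basis. LINT x|lborel. f b x)"
proof -
  interpret product_sigma_finite "\<lambda>_::'a. lborel :: real measure"
    by unfold_locales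
  have [measurable]: "f b \<in> borel_measurable borel" if "b \<in> Basis" for b
    using borel_measurable_integrable[OF int[OF that]] by simp
  have "(LINT x|lborel. (\<Prod>b\<in>Basis. f b (x \<bullet> b)))
      = (LINT g|(\<Pi>\<^sub>M b\<in>(Basis::'a set). lborel). (\<Prod>b\<in>Basis. f b ((\<Sum>b\<in>Basis. g b *\<^sub>R b) \<bullet> b)))"
    by (subst lborel_eq) (rule integral_distr; measurable)
  also have "\<dots> = (LINT g|(\<Pi>\<^sub>M b\<in>(Basis::'a set). lborel). (\<Prod>b\<in>Basis. f b (g b)))"
    by (intro Bochner_Integration.integral_cong prod.cong arg_cong2[of _ _ _ _ f] refl) simp
  also have "\<dots> = (\<Prod>b\<in>Basis. LINT x|lborel. f b x)"
    by (rule product_integral_prod) (auto intro: int)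
  finally show ?thesis .
qed

lemma integral_char_unit_interval:
  "(LINT t|lborel. indicator {0..1} t *\<^sub>R exp (\<i> * of_real (2 * pi * of_int m * t))) = (if m = 0 then 1 else 0 :: complex)"
proof (cases "m = 0")
  case False
  let ?w = "2 * of_real pi * \<i> * of_int m :: complex"
  have w: "?w \<noteq> 0" using False by simp
  have "((\<lambda>t. exp (?w * of_real t) / ?w) has_vector_derivative exp (?w * of_real t)) (at t within {0..1})" for t
    by (rule has_vector_derivative_real_field) (use w in \<open>auto intro!: derivative_eq_intros\<close>)
  then have "(LINT t|lborel. indicator {0..1} t *\<^sub>R exp (?w * of_real t)) = exp (?w * of_real 1) / ?w - exp (?w * of_real 0) / ?w"
    by (intro integral_FTC_atLeastAtMost) (auto intro!: continuous_intros)
  also have "exp (?w * of_real 1) = 1"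
    by (rule exp_eq_1[THEN iffD2]) auto
  finally show ?thesis using False by (simp add: algebra_simps)
qed simp

text \<open>
  The indicator of the cube times the character factors over the coordinates, and the integral over
  \<open>[0, 1]\<close> of a nontrivial one-dimensional character vanishes.
\<close>

lemma integral_torus_char:
  "(LINT x|torus_measure. torus_char (k::int^'n) x) = (if k = 0 then 1 else 0)"
proof -
  define \<phi> where "\<phi> b t = indicator {0..1} t *\<^sub>R exp (\<i> * of_real (2 * pi * of_int (k $ (SOME i. b = axis i 1)) * t))"
    for b :: "real^'n" and t :: real
  have ax: "(SOME j. axis i (1::real) = axis j 1) = i" for i :: 'n
    by (rule some_equality) (auto simp: axis_eq_axis)
  have inj: "inj (\<lambda>i::'n. axis i (1::real))" by (auto simp: inj_on_def axis_eq_axis)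
  have B: "(Basis :: (real^'n) set) = (\<lambda>i. axis i 1) ` UNIV" by (auto simp: Basis_vec_def)
  have ind: "(\<Prod>i\<in>UNIV. indicator {0..1} (x $ i)) = (indicator (cbox 0 1) x :: complex)" for x :: "real^'n"
  proof (cases "x \<in> cbox 0 1")
    case True
    then show ?thesis by (simp add: mem_box_cart)
  next
    case False
    then obtain i where "x $ i \<notin> {0..1}" by (auto simp: mem_box_cart)
    then have "(\<Prod>i\<in>UNIV. indicator {0..1} (x $ i)) = (0::complex)"
      by (intro prod_zero bexI[of _ i]) (simp_all add: indicator_def)
    then show ?thesis using False by simp
  qed
  have "indicator (cbox 0 1) x *\<^sub>R torus_char k x = (\<Prod>b\<in>Basis. \<phi> b (x \<bullet> b))" for x
  proof -
    have "(\<Prod>b\<in>Basis. \<phi> b (x \<bullet> b)) = (\<Prod>i\<in>UNIV. indicator {0..1} (x $ i) * exp (\<i> * of_real (2 * pi * of_int (k $ i) * x $ i)))"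
      unfolding B by (subst prod.reindex[OF inj]) (simp add: \<phi>_def ax inner_axis scaleR_conv_of_real of_real_indicator)
    also have "\<dots> = indicator (cbox 0 1) x * torus_char k x"
      by (simp add: prod.distrib ind torus_char_def exp_sum[symmetric] sum_distrib_left mult.assoc)
    finally show ?thesis by (simp add: scaleR_conv_of_real of_real_indicator)
  qed
  then have "(LINT x|torus_measure. torus_char k x) = (LINT x|lborel. (\<Prod>b\<in>Basis. \<phi> b (x \<bullet> b)))"
    by (simp add: torus_integrable_continuous(2)[OF continuous_torus_char])
  also have "\<dots> = (\<Prod>b\<in>Basis. LINT t|lborel. \<phi> b t)"
    by (rule integral_lborel_prod) (auto simp: \<phi>_def[abs_def] intro!: borel_integrable_compact continuous_intros)
  also have "\<dots> = (\<Prod>i\<in>UNIV. if k $ i = 0 then 1 else 0)"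
  proof -
    have "\<phi> (axis i 1) = (\<lambda>t. indicator {0..1} t *\<^sub>R exp (\<i> * of_real (2 * pi * of_int (k $ i) * t)))" for i
      by (simp add: fun_eq_iff \<phi>_def ax)
    then have "(LINT t|lborel. \<phi> (axis i 1) t) = (if k $ i = 0 then 1 else 0)" for i
      by (simp only: integral_char_unit_interval)
    then show ?thesis
      unfolding B by (simp add: prod.reindex[OF inj])
  qed
  also have "\<dots> = (if k = 0 then 1 else 0)"
    by (auto simp: vec_eq_iff)
  finally show ?thesis .
qed

lemma fourier_coeff_eq: "fourier_coeff f k = (LINT x|torus_measure. of_real (f x) * torus_char (- k) x)"
proof -
  have "torus_char (- k) x = exp (- 2 * of_real pi * \<i> * of_real (\<Sum>i\<in>UNIV. of_int (k $ i) * x $ i))" for x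
    by (simp add: torus_char_def sum_negf mult_ac)
  then show ?thesis by (simp add: fourier_coeff_def)
qed

inductive trig_poly :: "(real^'n \<Rightarrow> complex) \<Rightarrow> bool" where
  char: "trig_poly (\<lambda>x. c * torus_char k x)"
| add: "trig_poly f \<Longrightarrow> trig_poly g \<Longrightarrow> trig_poly (\<lambda>x. f x + g x)"

lemma trig_poly_const: "trig_poly (\<lambda>x. c)"
  using trig_poly.char[of c 0] by simp

lemma trig_poly_mult:
  assumes "trig_poly f" "trig_poly g"
  shows "trig_poly (\<lambda>x. f x * g x)"
  using assms
proof (induction f arbitrary: g rule: trig_poly.induct)
  case (char c k)
  show ?case using char
  proof (induction g rule: trig_poly.induct)
    case (char d l)
    show ?case using trig_poly.char[of "c * d" "k + l"] by (simp add: torus_char_plus algebra_simps)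
  next
    case (add f g)
    then show ?case using trig_poly.add by (fastforce simp: distrib_left)
  qed
next
  case (add f1 f2)
  then show ?case using trig_poly.add by (fastforce simp: distrib_right)
qed

lemma trig_poly_prod:
  "finite A \<Longrightarrow> (\<And>a. a \<in> A \<Longrightarrow> trig_poly (f a)) \<Longrightarrow> trig_poly (\<lambda>x. \<Prod>a\<in>A. f a x)"
  by (induction A rule: finite_induct) (auto intro: trig_poly_const trig_poly_mult)

lemma trig_poly_power: "trig_poly f \<Longrightarrow> trig_poly (\<lambda>x. f x ^ n)"
  by (induction n) (auto intro: trig_poly_const trig_poly_mult)

lemma trig_poly_continuous: "trig_poly f \<Longrightarrow> continuous_on UNIV f"
  by (induction rule: trig_poly.induct) (auto intro!: continuous_intros)

lemma trig_poly_cos: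
  "trig_poly (\<lambda>x :: real^'n. of_real (cos (2 * pi * (x $ i - y))))"
proof -
  have "torus_char (axis i m) x = exp (\<i> * of_real (2 * pi * of_int m * x $ i))" for m and x :: "real^'n"
    by (simp add: torus_char_def axis_def if_distrib[of of_int] if_distrib[of "\<lambda>a. a * _"] mult.assoc cong: if_cong)
  then have "of_real (cos (2 * pi * (x $ i - y)))
      = exp (- (\<i> * of_real (2 * pi * y))) / 2 * torus_char (axis i 1) x
        + exp (\<i> * of_real (2 * pi * y)) / 2 * torus_char (axis i (- 1)) x" for x :: "real^'n"
    by (simp add: cos_of_real[symmetric] cos_exp_eq exp_add[symmetric] add_divide_distrib algebra_simps del: cos_of_real)
  then show ?thesis by (simp only: trig_poly.add trig_poly.char)
qed

section \<open>A continuous function is determined by its Fourier coefficients\<close>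

lemma integral_trig_poly_zero:
  fixes h :: "real^'n \<Rightarrow> complex"
  assumes h: "continuous_on UNIV h" and zero: "\<And>k. (LINT x|torus_measure. h x * torus_char k x) = 0"
    and T: "trig_poly T"
  shows "(LINT x|torus_measure. h x * T x) = 0"
  using T
proof (induction rule: trig_poly.induct)
  case (char c k)
  have "(LINT x|torus_measure. h x * (c * torus_char k x)) = (LINT x|torus_measure. c * (h x * torus_char k x))"
    by (simp add: mult_ac)
  then show ?case using zero[of k] by simp
next
  case (add f g)
  have "integrable torus_measure (\<lambda>x. h x * T x)" if "trig_poly T" for T
    by (intro torus_integrable_continuous(1) continuous_on_mult h trig_poly_continuous that)
  note this[OF add.hyps(1)] this[OF add.hyps(2)]
  then show ?case using add.IH by (simp add: distrib_left)
qed

text \<open>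
  A trigonometric polynomial with values in \<open>[0, 1]\<close> that equals 1 exactly at the translates of \<open>y\<close> by
  integer vectors.  Its powers, slightly raised, concentrate at \<open>y\<close>.
\<close>

definition peak :: "real^'n \<Rightarrow> real^'n \<Rightarrow> real" where
  "peak y x = (\<Prod>i\<in>UNIV. (1 / 2 + cos (2 * pi * (x $ i - y $ i)) / 2))"

lemma peak_nonneg: "0 \<le> peak y x"
proof -
  have "0 \<le> 1 / 2 + cos t / 2" for t :: real
    using cos_ge_minus_one[of t] by linarith
  then show ?thesis
    unfolding peak_def by (intro prod_nonneg) auto
qed

lemma peak_self: "peak y y = 1"
  by (simp add: peak_def)

lemma continuous_peak: "continuous_on UNIV (peak y)"
  unfolding peak_def[abs_def] by (intro continuous_intros) auto

lemma trig_poly_peak: "trig_poly (\<lambda>x. of_real (peak y x))"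
proof -
  have "trig_poly (\<lambda>x. \<Prod>i\<in>UNIV. 1 / 2 + 1 / 2 * of_real (cos (2 * pi * (x $ i - y $ i))))"
    by (intro trig_poly_prod trig_poly_mult trig_poly_const trig_poly.add trig_poly_cos) simp
  then show ?thesis by (simp add: peak_def)
qed

lemma peak_less_1:
  fixes x y :: "real^'n"
  assumes "x \<in> cbox 0 1" "y \<in> box 0 1" "x \<noteq> y"
  shows "peak y x < 1"
proof -
  obtain i where i: "x $ i \<noteq> y $ i" using assms(3) by (auto simp: vec_eq_iff)
  let ?c = "\<lambda>j. (1 / 2 + cos (2 * pi * (x $ j - y $ j)) / 2)"
  have "cos (2 * pi * (x $ i - y $ i)) \<noteq> 1"
  proof
    assume "cos (2 * pi * (x $ i - y $ i)) = 1"
    then obtain n :: int where "2 * pi * (x $ i - y $ i) = of_int n * 2 * pi"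
      by (auto simp: cos_one_2pi_int)
    then have n: "x $ i - y $ i = of_int n" by simp
    have "0 \<le> x $ i" "x $ i \<le> 1" "0 < y $ i" "y $ i < 1"
      using assms by (auto simp: mem_box_cart)
    then have "\<bar>of_int n :: real\<bar> < 1" using n by linarith
    then have "n = 0" by linarith
    with n i show False by simp
  qed
  then have "cos (2 * pi * (x $ i - y $ i)) < 1"
    using cos_le_one by (metis order.not_eq_order_implies_strict)
  then have ci: "?c i < 1" by linarith
  have bounds: "0 \<le> ?c j \<and> ?c j \<le> 1" for j
    using cos_ge_minus_one[of "2 * pi * (x $ j - y $ j)"] cos_le_one[of "2 * pi * (x $ j - y $ j)"]
    by (intro conjI; linarith)
  have "peak y x = ?c i * (\<Prod>j\<in>UNIV - {i}. ?c j)"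
    unfolding peak_def by (rule prod.remove) auto
  also have "\<dots> \<le> ?c i * 1"
    using bounds by (intro mult_left_mono prod_le_1) auto
  finally show ?thesis using ci by simp
qed

text \<open>
  Suppose \<open>g y > 0\<close>, and let \<open>U\<close> be a neighbourhood of \<open>y\<close> on which \<open>g > g y / 2\<close>.  By compactness the peak
  at \<open>y\<close> is at most some \<open>\<kappa> < 1\<close> on the rest of the cube.  The trigonometric polynomial
  \<open>T = peak + (1 - \<kappa>)\<close> then takes values in \<open>[0, 1]\<close> outside \<open>U\<close>, is nonnegative on \<open>U\<close> and exceeds some
  \<open>1 + \<eta> > 1\<close> on a ball around \<open>y\<close>.  So \<open>\<integral> g T\<^sup>N\<close> is at least a positive multiple of \<open>(1 + \<eta>)\<^sup>N\<close>
  minus a constant and cannot vanish for all \<open>N\<close>.  Taking \<open>y\<close> in the open cube ensures that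
  \<open>y\<close> is the only point of the closed cube at which the peak reaches 1.
\<close>

lemma nonpos_of_orthogonal_trig_poly:
  fixes g :: "real^'n \<Rightarrow> real"
  assumes g: "continuous_on UNIV g"
    and orth: "\<And>T. trig_poly (\<lambda>x. of_real (T x)) \<Longrightarrow> (LINT x|torus_measure. g x * T x) = 0"
    and y: "y \<in> box 0 1"
  shows "g y \<le> 0"
proof (rule ccontr)
  assume "\<not> g y \<le> 0"
  then have gy: "g y > 0" by simp
  let ?Q = "cbox 0 1 :: (real^'n) set"
  define U where "U = box 0 1 \<inter> {x. g y / 2 < g x}"
  have oU: "open U" unfolding U_def by (intro open_Int open_box open_Collect_less continuous_intros g)
  have yU: "y \<in> U" using y gy by (simp add: U_def)
  have "compact (?Q - U)" using oU by (intro compact_diff) auto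
  moreover have "0 \<in> ?Q - U" by (simp add: U_def mem_box_cart)
  ultimately obtain z where z: "z \<in> ?Q - U" and z_max: "\<forall>x\<in>?Q - U. peak y x \<le> peak y z"
    using continuous_attains_sup[of "?Q - U" "peak y"] continuous_on_subset[OF continuous_peak] by blast
  define \<kappa> where "\<kappa> = peak y z"
  have \<kappa>: "0 \<le> \<kappa>" "\<kappa> < 1" using peak_nonneg peak_less_1[of z y] z yU y by (auto simp: \<kappa>_def)
  define T where "T x = peak y x + (1 - \<kappa>)" for x
  have T0: "0 \<le> T x" for x using peak_nonneg[of y x] \<kappa> by (simp add: T_def)
  have T1: "T x \<le> 1" if "x \<in> ?Q - U" for x using z_max that by (auto simp: T_def \<kappa>_def)
  have contT: "continuous_on UNIV T" unfolding T_def[abs_def] by (intro continuous_intros continuous_peak)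
  define \<eta> where "\<eta> = (1 - \<kappa>) / 2"
  have \<eta>: "\<eta> > 0" using \<kappa> by (simp add: \<eta>_def)
  have "open (U \<inter> {x. 1 + \<eta> < T x})" by (intro open_Int oU open_Collect_less continuous_intros contT)
  moreover have "y \<in> U \<inter> {x. 1 + \<eta> < T x}"
    using yU \<kappa> by (simp add: T_def peak_self \<eta>_def field_simps)
  ultimately obtain r where r: "r > 0" "cball y r \<subseteq> U \<inter> {x. 1 + \<eta> < T x}"
    using open_contains_cball by blast
  obtain M where M: "\<And>x. x \<in> ?Q \<Longrightarrow> \<bar>g x\<bar> \<le> M" "M \<ge> 0"
  proof -
    have "compact (g ` ?Q)" by (intro compact_continuous_image continuous_on_subset[OF g]) auto
    then obtain M where "\<forall>x\<in>g ` ?Q. norm x \<le> M" using compact_imp_bounded bounded_iff by blast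
    then show ?thesis by (intro that[of "\<bar>M\<bar>"]) fastforce+
  qed
  have fin: "emeasure lborel (cball y r) < \<infinity>"
    using emeasure_bounded_finite[of "cball y r"] by simp
  define v where "v = measure lborel (cball y r)"
  have v: "v > 0" unfolding v_def by (rule content_cball_pos) fact
  \<comment> \<open>the orthogonality relation, tested with \<open>T\<^sup>N\<close>\<close>
  have lower: "g y / 2 * (1 + \<eta>) ^ N * v \<le> M" for N
  proof -
    let ?F = "\<lambda>x. indicator ?Q x *\<^sub>R (g x * T x ^ N)"
    \<comment> \<open>a minorant of the integrand \<open>?F\<close> whose integral is explicit\<close>
    let ?G = "\<lambda>x. g y / 2 * (1 + \<eta>) ^ N * indicator (cball y r) x - M * indicator ?Q x :: real"
    have "trig_poly (\<lambda>x. (of_real (peak y x) + of_real (1 - \<kappa>)) ^ N)"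
      by (intro trig_poly_power trig_poly.add trig_poly_peak trig_poly_const)
    then have "trig_poly (\<lambda>x. of_real (T x ^ N))" by (simp add: T_def)
    then have "(LINT x|torus_measure. g x * T x ^ N) = 0" by (rule orth)
    moreover have cont: "continuous_on UNIV (\<lambda>x. g x * T x ^ N)" by (intro continuous_intros g contT)
    ultimately have F0: "(LINT x|lborel. ?F x) = 0"
      using torus_integrable_continuous(2)[OF cont] by simp
    have F: "integrable lborel ?F"
      by (intro borel_integrable_compact continuous_on_subset[OF cont]) auto
    have G: "integrable lborel ?G"
      by (intro Bochner_Integration.integrable_diff integrable_mult_right integrable_real_indicator)
        (auto simp: emeasure_lborel_cbox_eq fin[simplified])
    have "?G x \<le> ?F x" for x
    proof (cases "x \<in> ?Q")
      case False
      then have "x \<notin> cball y r" using r U_def box_subset_cbox by blast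
      then show ?thesis using False by simp
    next
      case Q: True
      show ?thesis
      proof (cases "x \<in> U")
        case True
        then have gx: "g y / 2 \<le> g x" by (simp add: U_def)
        show ?thesis
        proof (cases "x \<in> cball y r")
          case True
          then have "1 + \<eta> \<le> T x" using r by auto
          then have "(1 + \<eta>) ^ N \<le> T x ^ N" using \<eta> by (intro power_mono) auto
          then have "g y / 2 * (1 + \<eta>) ^ N \<le> g x * T x ^ N"
            using gx gy \<eta> by (intro mult_mono) auto
          then show ?thesis using M(2) Q True by simp
        next
          case False
          have "0 \<le> g x * T x ^ N" using gx gy T0 by (intro mult_nonneg_nonneg) auto
          then show ?thesis using M(2) Q False by simp
        qed
      next
        case False
        then have "x \<notin> cball y r" using r by auto
        moreover have "\<bar>g x * T x ^ N\<bar> \<le> M * 1"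
          unfolding abs_mult using T0 T1[of x] Q False M
          by (intro mult_mono) (auto simp: power_le_one)
        ultimately show ?thesis using Q by simp
      qed
    qed
    then have "(LINT x|lborel. ?G x) \<le> (LINT x|lborel. ?F x)"
      by (intro integral_mono F G)
    moreover have "(LINT x|lborel. ?G x) = g y / 2 * (1 + \<eta>) ^ N * v - M"
    proof -
      have "measure lborel ?Q = 1"
        by (subst content_cbox_cart) (auto simp: mem_box_cart interval_ne_empty_cart)
      then show ?thesis
        by (subst Bochner_Integration.integral_diff)
          (auto simp: v_def emeasure_lborel_cbox_eq fin[simplified] intro!: integrable_mult_right integrable_real_indicator)
    qed
    ultimately show ?thesis using F0 by simp
  qed
  obtain N where "M / (g y / 2 * v) < (1 + \<eta>) ^ N"
    using real_arch_pow[of "1 + \<eta>" "M / (g y / 2 * v)"] \<eta> by auto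
  then have "M < g y / 2 * (1 + \<eta>) ^ N * v"
    using gy v by (simp add: field_simps)
  with lower[of N] show False by simp
qed

text \<open>
  The test functions of the previous lemma are real-valued, so it applies to \<open>\<plusminus> Re h\<close>.  This gives
  the claim inside the unit cube; continuity extends it to the boundary, and periodicity to the whole space.
\<close>

lemma Re_zero_of_fourier_coeffs_zero:
  fixes h :: "real^'n \<Rightarrow> complex"
  assumes h: "continuous_on UNIV h" "periodic_fun h"
    and zero: "\<And>k. (LINT x|torus_measure. h x * torus_char k x) = 0"
  shows "Re (h x) = 0"
proof -
  have orth: "(LINT x|torus_measure. Re (h x) * T x) = 0" if T: "trig_poly (\<lambda>x. of_real (T x))" for T
  proof -
    have "continuous_on UNIV (\<lambda>x. h x * of_real (T x))"
      by (intro continuous_intros h trig_poly_continuous[OF T])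
    then have "integrable torus_measure (\<lambda>x. h x * of_real (T x))" by (rule torus_integrable_continuous)
    from integral_Re[OF this] show ?thesis
      using integral_trig_poly_zero[OF h(1) zero T] by simp
  qed
  have R: "continuous_on UNIV (\<lambda>x. Re (h x))" by (intro continuous_intros h)
  have inner: "Re (h y) = 0" if "y \<in> box 0 1" for y
  proof (rule antisym)
    show "Re (h y) \<le> 0" by (rule nonpos_of_orthogonal_trig_poly[OF R orth that])
    have "- Re (h y) \<le> 0"
      by (rule nonpos_of_orthogonal_trig_poly[of "\<lambda>x. - Re (h x)"])
        (use R orth that in \<open>auto intro: continuous_intros\<close>)
    then show "0 \<le> Re (h y)" by simp
  qed
  have ne: "box 0 1 \<noteq> ({} :: (real^'n) set)" by (simp add: interval_ne_empty_cart)
  have "closed {x. Re (h x) = 0}" using R by (intro closed_Collect_eq) auto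
  moreover have "box 0 1 \<subseteq> {x. Re (h x) = 0}" using inner by auto
  ultimately have "closure (box 0 1) \<subseteq> {x. Re (h x) = 0}" by (intro closure_minimal)
  then have "cbox 0 1 \<subseteq> {x. Re (h x) = 0}" by (simp add: closure_box[OF ne])
  then show ?thesis
    using periodic_fun_unit_cube[OF h(2), of x] by (metis (mono_tags) mem_Collect_eq subsetD)
qed

section \<open>Regularity of Fourier series\<close>

lemma has_sum_diff:
  fixes f g :: "'a \<Rightarrow> 'b::topological_ab_group_add"
  assumes "(f has_sum a) A" "(g has_sum b) A"
  shows "((\<lambda>x. f x - g x) has_sum (a - b)) A"
  using has_sum_add[OF assms(1), of "\<lambda>x. - g x" "- b"] assms(2) by (simp add: has_sum_uminus)

text \<open>
  The weight in the definition of the Sobolev spaces.  It bounds both \<open>\<bar>k\<^sub>i\<bar>\<close> and \<open>k\<^sub>i\<^sup>2\<close>, so one factor of it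
  pays for one derivative and also for the quadratic Taylor remainder of a character.
\<close>

definition freq_weight :: "int^'n \<Rightarrow> real" where
  "freq_weight k = 1 + (\<Sum>i\<in>UNIV. (of_int (k $ i))\<^sup>2)"

definition fourier_series :: "(int^'n \<Rightarrow> complex) \<Rightarrow> real^'n \<Rightarrow> complex" where
  "fourier_series c x = (\<Sum>\<^sub>\<infinity>k. c k * torus_char k x)"

lemma freq_weight_ge_1: "1 \<le> freq_weight k"
  by (simp add: freq_weight_def sum_nonneg)

lemma freq_weight_nonneg: "0 \<le> freq_weight k"
  using freq_weight_ge_1[of k] by simp

lemma freq_weight_ge_square: "(of_int (k $ i))\<^sup>2 \<le> freq_weight k"
proof -
  have "(of_int (k $ i) :: real)\<^sup>2 \<le> (\<Sum>i\<in>UNIV. (of_int (k $ i))\<^sup>2)"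
    by (rule member_le_sum) auto
  then show ?thesis by (simp add: freq_weight_def)
qed

lemma freq_weight_ge_abs: "\<bar>of_int (k $ i)\<bar> \<le> freq_weight k"
proof -
  have "\<bar>k $ i\<bar> \<le> (k $ i)\<^sup>2"
  proof (cases "k $ i = 0")
    case False
    then have "\<bar>k $ i\<bar> * 1 \<le> \<bar>k $ i\<bar> * \<bar>k $ i\<bar>" by (intro mult_left_mono) auto
    then show ?thesis by (simp add: power2_eq_square)
  qed simp
  then have "\<bar>of_int (k $ i) :: real\<bar> \<le> (of_int (k $ i))\<^sup>2"
    unfolding of_int_abs[symmetric] of_int_power[symmetric] of_int_le_iff .
  then show ?thesis by (rule order_trans) (rule freq_weight_ge_square)
qed

lemma summable_weight_mono:
  assumes "(\<lambda>k. freq_weight k ^ m * norm (c k)) summable_on UNIV" "l \<le> m"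
  shows "(\<lambda>k. freq_weight k ^ l * norm (c k)) summable_on UNIV"
  using assms(1)
proof (rule summable_on_comparison_test)
  fix k
  show "freq_weight k ^ l * norm (c k) \<le> freq_weight k ^ m * norm (c k)"
    by (intro mult_right_mono power_increasing assms(2) freq_weight_ge_1) auto
  show "0 \<le> freq_weight k ^ l * norm (c k)"
    using freq_weight_nonneg[of k] by simp
qed

lemma fourier_series_has_sum:
  assumes "(\<lambda>k. norm (c k)) summable_on UNIV"
  shows "((\<lambda>k. c k * torus_char k x) has_sum fourier_series c x) UNIV"
  unfolding fourier_series_def
  by (rule has_sum_infsum, rule abs_summable_summable) (simp add: norm_mult assms)

lemma periodic_fourier_series: "periodic_fun (fourier_series (c :: int^'n \<Rightarrow> complex))"
proof -
  have "torus_char k (x + axis i 1) = torus_char k x" for k :: "int^'n" and x i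
    using periodic_torus_char[of k] by (simp only: periodic_fun_def)
  then show ?thesis by (simp add: periodic_fun_def fourier_series_def)
qed

lemma norm_iexp_minus_1: "norm (exp (\<i> * of_real t) - 1) \<le> \<bar>t\<bar>"
  using iexp_approx1[of t 0] by simp

lemma norm_iexp_minus_linear: "norm (exp (\<i> * of_real t) - 1 - \<i> * of_real t) \<le> t\<^sup>2 / 2"
  using iexp_approx1[of t 1] by (simp add: power2_eq_square diff_diff_eq)

lemma torus_char_lipschitz:
  "norm (torus_char k x - torus_char k y) \<le> 2 * pi * CARD('n) * freq_weight k * norm (x - y)"
  for k :: "int^'n"
proof -
  define t where "t = 2 * pi * (\<Sum>i\<in>UNIV. of_int (k $ i) * (x - y) $ i)"
  have "2 * pi * (\<Sum>i\<in>UNIV. of_int (k $ i) * x $ i) = 2 * pi * (\<Sum>i\<in>UNIV. of_int (k $ i) * y $ i) + t"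
    unfolding t_def distrib_left[symmetric] sum.distrib[symmetric] by simp
  then have "torus_char k x = torus_char k y * exp (\<i> * of_real t)"
    unfolding torus_char_def by (simp only: of_real_add distrib_left exp_add)
  then have "norm (torus_char k x - torus_char k y) = norm (torus_char k y * (exp (\<i> * of_real t) - 1))"
    by (simp add: algebra_simps)
  also have "\<dots> \<le> \<bar>t\<bar>" by (simp add: norm_mult norm_iexp_minus_1)
  also have "\<dots> = 2 * pi * \<bar>\<Sum>i\<in>UNIV. of_int (k $ i) * (x - y) $ i\<bar>"
    by (simp add: t_def abs_mult)
  also have "\<dots> \<le> 2 * pi * (\<Sum>i\<in>(UNIV::'n set). freq_weight k * norm (x - y))"
  proof -
    have "\<bar>\<Sum>i\<in>UNIV. of_int (k $ i) * (x - y) $ i\<bar> \<le> (\<Sum>i\<in>UNIV. \<bar>of_int (k $ i) * (x - y) $ i\<bar>)"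
      by (rule sum_abs)
    also have "\<dots> \<le> (\<Sum>i\<in>(UNIV::'n set). freq_weight k * norm (x - y))"
      unfolding abs_mult using freq_weight_nonneg[of k]
      by (intro sum_mono mult_mono freq_weight_ge_abs component_le_norm_cart) auto
    finally show ?thesis by simp
  qed
  finally show ?thesis by (simp add: mult_ac)
qed

lemma continuous_fourier_series:
  fixes c :: "int^'n \<Rightarrow> complex"
  assumes "(\<lambda>k. freq_weight k * norm (c k)) summable_on UNIV"
  shows "continuous_on UNIV (fourier_series c)"
proof -
  have "(\<lambda>k. norm (c k)) summable_on UNIV"
    using summable_weight_mono[of 1 c 0] assms by simp
  note sums = fourier_series_has_sum[OF this]
  define A where "A = (\<Sum>\<^sub>\<infinity>k. freq_weight k * norm (c k))"
  have A: "((\<lambda>k. freq_weight k * norm (c k)) has_sum A) UNIV"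
    unfolding A_def using assms by (rule has_sum_infsum)
  have A0: "A \<ge> 0" unfolding A_def by (intro infsum_nonneg mult_nonneg_nonneg freq_weight_nonneg norm_ge_zero)
  define L where "L = 2 * pi * CARD('n) * A"
  have "norm (fourier_series c x - fourier_series c y) \<le> L * norm (x - y)" for x y
  proof (rule norm_infsum_le)
    show "((\<lambda>k. c k * torus_char k x - c k * torus_char k y) has_sum
        fourier_series c x - fourier_series c y) UNIV"
      by (intro has_sum_diff sums)
    have "((\<lambda>k. (2 * pi * CARD('n) * norm (x - y)) * (freq_weight k * norm (c k))) has_sum
        (2 * pi * CARD('n) * norm (x - y)) * A) UNIV"
      by (intro has_sum_cmult_right A)
    then show "((\<lambda>k. 2 * pi * CARD('n) * norm (x - y) * (freq_weight k * norm (c k))) has_sum L * norm (x - y)) UNIV"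
      by (simp add: L_def mult_ac)
    fix k
    have "norm (c k * torus_char k x - c k * torus_char k y) = norm (c k) * norm (torus_char k x - torus_char k y)"
      by (simp only: right_diff_distrib[symmetric] norm_mult)
    also have "\<dots> \<le> norm (c k) * (2 * pi * CARD('n) * freq_weight k * norm (x - y))"
      by (intro mult_left_mono torus_char_lipschitz norm_ge_zero)
    finally show "norm (c k * torus_char k x - c k * torus_char k y)
        \<le> 2 * pi * CARD('n) * norm (x - y) * (freq_weight k * norm (c k))"
      by (simp only: mult_ac)
  qed
  then have "L-lipschitz_on UNIV (fourier_series c)"
    using A0 by (intro lipschitz_onI) (simp_all add: dist_norm L_def)
  then show ?thesis by (rule lipschitz_on_continuous_on)
qed

text \<open>
  Termwise differentiation of a Fourier series goes through this criterion: quadratic remainder bounds of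
  the single terms, valid for all \<open>t\<close>, can simply be added up.
\<close>

lemma has_vector_derivative_of_quadratic_remainder:
  fixes F :: "real \<Rightarrow> 'a::real_normed_vector"
  assumes "\<And>t. norm (F t - F 0 - t *\<^sub>R D) \<le> B * t\<^sup>2"
  shows "(F has_vector_derivative D) (at 0)"
  unfolding has_vector_derivative_def has_derivative_at_alt
proof (intro conjI allI impI)
  show "bounded_linear (\<lambda>t. t *\<^sub>R D)" by (rule bounded_linear_scaleR_left)
  fix e :: real assume e: "e > 0"
  show "\<exists>d>0. \<forall>t. norm (t - 0) < d \<longrightarrow> norm (F t - F 0 - (t - 0) *\<^sub>R D) \<le> e * norm (t - 0)"
  proof (intro exI[of _ "e / (\<bar>B\<bar> + 1)"] conjI allI impI)
    fix t :: real assume t: "norm (t - 0) < e / (\<bar>B\<bar> + 1)"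
    have "norm (F t - F 0 - (t - 0) *\<^sub>R D) \<le> B * t\<^sup>2" using assms[of t] by simp
    also have "\<dots> \<le> (\<bar>B\<bar> + 1) * t\<^sup>2" by (intro mult_right_mono) auto
    also have "\<dots> = ((\<bar>B\<bar> + 1) * \<bar>t\<bar>) * \<bar>t\<bar>" by (simp add: power2_eq_square)
    also have "\<dots> \<le> e * \<bar>t\<bar>"
      using t by (intro mult_right_mono) (auto simp: field_simps)
    finally show "norm (F t - F 0 - (t - 0) *\<^sub>R D) \<le> e * norm (t - 0)" by simp
  qed (use e in simp)
qed

lemma fourier_series_has_pderiv:
  fixes c :: "int^'n \<Rightarrow> complex"
  assumes "(\<lambda>k. freq_weight k * norm (c k)) summable_on UNIV"
  shows "((\<lambda>t. fourier_series c (x + t *\<^sub>R axis i 1)) has_vector_derivative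
     fourier_series (\<lambda>k. \<i> * of_real (2 * pi * of_int (k $ i)) * c k) x) (at 0)"
proof -
  let ?d = "\<lambda>k. \<i> * of_real (2 * pi * of_int (k $ i)) * c k"
  have "(\<lambda>k. norm (c k)) summable_on UNIV"
    using summable_weight_mono[of 1 c 0] assms by simp
  note sums = fourier_series_has_sum[OF this]
  have "(\<lambda>k. 2 * pi * (freq_weight k * norm (c k))) summable_on UNIV"
    by (intro summable_on_cmult_right assms)
  then have "(\<lambda>k. norm (?d k)) summable_on UNIV"
  proof (rule summable_on_comparison_test)
    show "norm (?d k) \<le> 2 * pi * (freq_weight k * norm (c k))" for k
      using mult_right_mono[OF freq_weight_ge_abs[of k i], of "norm (c k)"]
      by (simp add: norm_mult mult.assoc)
  qed simp
  note sums' = fourier_series_has_sum[OF this]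
  define A where "A = (\<Sum>\<^sub>\<infinity>k. freq_weight k * norm (c k))"
  have A: "((\<lambda>k. freq_weight k * norm (c k)) has_sum A) UNIV"
    unfolding A_def using assms by (rule has_sum_infsum)
  show ?thesis
  proof (rule has_vector_derivative_of_quadratic_remainder)
    fix t :: real
    let ?e = "axis i 1 :: real^'n"
    have "norm (fourier_series c (x + t *\<^sub>R ?e) - fourier_series c x - of_real t * fourier_series ?d x) \<le> 2 * pi\<^sup>2 * t\<^sup>2 * A"
    proof (rule norm_infsum_le)
      show "((\<lambda>k. c k * torus_char k (x + t *\<^sub>R ?e) - c k * torus_char k x - of_real t * (?d k * torus_char k x)) has_sum
        (fourier_series c (x + t *\<^sub>R ?e) - fourier_series c x - of_real t * fourier_series ?d x)) UNIV"
        by (intro has_sum_diff has_sum_cmult_right sums sums')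
      show "((\<lambda>k. 2 * pi\<^sup>2 * t\<^sup>2 * (freq_weight k * norm (c k))) has_sum 2 * pi\<^sup>2 * t\<^sup>2 * A) UNIV"
        by (intro has_sum_cmult_right A)
      fix k
      define u where "u = 2 * pi * of_int (k $ i) * t"
      have "c k * torus_char k (x + t *\<^sub>R ?e) - c k * torus_char k x - of_real t * (?d k * torus_char k x)
          = c k * torus_char k x * (exp (\<i> * of_real u) - 1 - \<i> * of_real u)"
        by (simp add: torus_char_shift u_def algebra_simps)
      then have "norm (c k * torus_char k (x + t *\<^sub>R ?e) - c k * torus_char k x - of_real t * (?d k * torus_char k x))
          = norm (c k) * norm (exp (\<i> * of_real u) - 1 - \<i> * of_real u)"
        by (simp only: norm_mult norm_torus_char mult_1_right)
      also have "\<dots> \<le> norm (c k) * (u\<^sup>2 / 2)"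
        by (intro mult_left_mono norm_iexp_minus_linear) simp
      also have "u\<^sup>2 / 2 = 2 * pi\<^sup>2 * t\<^sup>2 * (of_int (k $ i))\<^sup>2"
        by (simp add: u_def power2_eq_square)
      also have "norm (c k) * (2 * pi\<^sup>2 * t\<^sup>2 * (of_int (k $ i))\<^sup>2) \<le> norm (c k) * (2 * pi\<^sup>2 * t\<^sup>2 * freq_weight k)"
        by (intro mult_left_mono freq_weight_ge_square) auto
      finally show "norm (c k * torus_char k (x + t *\<^sub>R ?e) - c k * torus_char k x - of_real t * (?d k * torus_char k x))
          \<le> 2 * pi\<^sup>2 * t\<^sup>2 * (freq_weight k * norm (c k))"
        by (simp add: mult_ac)
    qed
    then show "norm (fourier_series c (x + t *\<^sub>R ?e) - fourier_series c (x + 0 *\<^sub>R ?e) - t *\<^sub>R fourier_series ?d x)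
        \<le> (2 * pi\<^sup>2 * A) * t\<^sup>2"
      by (simp add: scaleR_conv_of_real mult_ac)
  qed
qed

text \<open>
  Each derivative multiplies the coefficients by \<open>2 \<pi> \<i> k\<^sub>i\<close> and costs one power of the weight.  The
  last power makes the derivatives of top order Lipschitz, hence continuous.
\<close>

lemma torus_C_fourier_series:
  fixes c :: "int^'n \<Rightarrow> complex"
  assumes "(\<lambda>k. freq_weight k ^ Suc m * norm (c k)) summable_on UNIV"
  shows "torus_C m (fourier_series c)"
  using assms
proof (induction m arbitrary: c)
  case 0
  then show ?case by (simp add: periodic_fourier_series continuous_fourier_series)
next
  case (Suc m)
  have 1: "(\<lambda>k. freq_weight k * norm (c k)) summable_on UNIV"
    using summable_weight_mono[OF Suc.prems, of 1] by simp
  show ?case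
  proof (rule torus_C_SucI)
    show "((\<lambda>t. fourier_series c (x + t *\<^sub>R axis i 1)) has_vector_derivative
     fourier_series (\<lambda>k. \<i> * of_real (2 * pi * of_int (k $ i)) * c k) x) (at 0)" for i x
      by (rule fourier_series_has_pderiv[OF 1])
    fix i :: 'n
    have "(\<lambda>k. 2 * pi * (freq_weight k ^ Suc (Suc m) * norm (c k))) summable_on UNIV"
      by (intro summable_on_cmult_right Suc.prems)
    then have "(\<lambda>k. freq_weight k ^ Suc m * norm (\<i> * of_real (2 * pi * of_int (k $ i)) * c k)) summable_on UNIV"
    proof (rule summable_on_comparison_test)
      fix k :: "int^'n"
      have W: "0 \<le> freq_weight k ^ Suc m"
        using freq_weight_nonneg[of k] by simp
      have "freq_weight k ^ Suc m * (\<bar>of_int (k $ i)\<bar> * norm (c k)) \<le> freq_weight k ^ Suc m * (freq_weight k * norm (c k))"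
        by (intro mult_left_mono mult_right_mono freq_weight_ge_abs W) simp
      then have "2 * pi * (freq_weight k ^ Suc m * (\<bar>of_int (k $ i)\<bar> * norm (c k)))
          \<le> 2 * pi * (freq_weight k ^ Suc m * (freq_weight k * norm (c k)))"
        by (rule mult_left_mono) simp
      moreover have "norm (\<i> * of_real (2 * pi * of_int (k $ i)) * c k) = 2 * pi * (\<bar>of_int (k $ i)\<bar> * norm (c k))"
        by (simp add: norm_mult)
      ultimately show "freq_weight k ^ Suc m * norm (\<i> * of_real (2 * pi * of_int (k $ i)) * c k)
          \<le> 2 * pi * (freq_weight k ^ Suc (Suc m) * norm (c k))"
        by (simp add: mult_ac)
      show "0 \<le> freq_weight k ^ Suc m * norm (\<i> * of_real (2 * pi * of_int (k $ i)) * c k)"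
        using W by (rule mult_nonneg_nonneg) simp
    qed
    then show "torus_C m (fourier_series (\<lambda>k. \<i> * of_real (2 * pi * of_int (k $ i)) * c k))"
      by (rule Suc.IH)
  qed (simp_all add: periodic_fourier_series continuous_fourier_series[OF 1])
qed

lemma torus_C_Re: "torus_C m f \<Longrightarrow> torus_C m (\<lambda>x. Re (f x))"
proof (induction m arbitrary: f)
  case 0
  then show ?case by (auto simp: periodic_fun_def intro: continuous_intros)
next
  case (Suc m)
  show ?case
  proof (rule torus_C_SucI)
    show "((\<lambda>t. Re (f (x + t *\<^sub>R axis i 1))) has_vector_derivative Re (pderiv_dir i f x)) (at 0)" for i x
      by (rule bounded_linear.has_vector_derivative[OF bounded_linear_Re torus_C_has_pderiv[OF Suc.prems]])
    show "torus_C m (\<lambda>x. Re (pderiv_dir i f x))" for i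
      by (rule Suc.IH[OF torus_C_pderiv[OF Suc.prems]])
  qed (use Suc.prems in \<open>auto simp: periodic_fun_def intro: continuous_intros\<close>)
qed

text \<open>
  For a partial sum over a finite set of frequencies containing \<open>j\<close> this is orthogonality, and such partial sums
  approximate the series uniformly.
\<close>

lemma fourier_coeff_of_series:
  fixes c :: "int^'n \<Rightarrow> complex"
  assumes c: "(\<lambda>k. freq_weight k * norm (c k)) summable_on UNIV"
  shows "(LINT x|torus_measure. fourier_series c x * torus_char (- j) x) = c j"
proof -
  have abs: "(\<lambda>k. norm (c k)) summable_on UNIV"
    using summable_weight_mono[of 1 c 0] c by simp
  define A where "A = (\<Sum>\<^sub>\<infinity>k. norm (c k))"
  have A: "((\<lambda>k. norm (c k)) has_sum A) UNIV"
    unfolding A_def using abs by (rule has_sum_infsum)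
  let ?I = "LINT x|torus_measure. fourier_series c x * torus_char (- j) x"
  have "norm (?I - c j) \<le> e" if "e > 0" for e
  proof -
    have "\<forall>\<^sub>F F in finite_subsets_at_top UNIV. dist (\<Sum>k\<in>F. norm (c k)) A < e"
      using A that unfolding has_sum_def tendsto_iff by blast
    then obtain X where X: "finite X" "\<And>Y. finite Y \<Longrightarrow> X \<subseteq> Y \<Longrightarrow> dist (\<Sum>k\<in>Y. norm (c k)) A < e"
      unfolding eventually_finite_subsets_at_top by auto
    define F where "F = insert j X"
    have F: "finite F" "j \<in> F" and tail: "dist (\<Sum>k\<in>F. norm (c k)) A < e"
      using X by (auto simp: F_def)
    let ?P = "\<lambda>x. \<Sum>k\<in>F. c k * torus_char k x"
    have "norm ((fourier_series c x - ?P x) * torus_char (- j) x) \<le> e" for x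
    proof -
      have "norm (fourier_series c x - ?P x) \<le> A - (\<Sum>k\<in>F. norm (c k))"
      proof (rule norm_infsum_le)
        show "((\<lambda>k. c k * torus_char k x) has_sum fourier_series c x - ?P x) (UNIV - F)"
          by (intro has_sum_Diff fourier_series_has_sum abs has_sum_finite F) simp
        show "((\<lambda>k. norm (c k)) has_sum A - (\<Sum>k\<in>F. norm (c k))) (UNIV - F)"
          by (intro has_sum_Diff A has_sum_finite F) simp
      qed (simp add: norm_mult)
      with tail show ?thesis by (simp add: norm_mult dist_real_def)
    qed
    then have "norm (LINT x|torus_measure. (fourier_series c x - ?P x) * torus_char (- j) x) \<le> e"
      by (rule torus_integral_norm_le)
    moreover have "(LINT x|torus_measure. (fourier_series c x - ?P x) * torus_char (- j) x) = ?I - c j"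
    proof -
      have int: "integrable torus_measure (\<lambda>x. c k * torus_char (k - j) x)" for k
        by (intro torus_integrable_continuous(1) continuous_intros)
      have "?P x * torus_char (- j) x = (\<Sum>k\<in>F. c k * torus_char (k - j) x)" for x
        using torus_char_plus[of _ "- j" x] by (simp add: sum_distrib_right mult.assoc)
      moreover have "(LINT x|torus_measure. (\<Sum>k\<in>F. c k * torus_char (k - j) x)) = (\<Sum>k\<in>F. if k = j then c j else 0)"
        by (subst Bochner_Integration.integral_sum[OF int])
          (auto simp: integral_torus_char intro!: sum.cong)
      ultimately have "(LINT x|torus_measure. ?P x * torus_char (- j) x) = c j"
        using F by simp
      moreover have "integrable torus_measure (\<lambda>x. fourier_series c x * torus_char (- j) x)"
        by (intro torus_integrable_continuous(1) continuous_on_mult continuous_torus_char continuous_fourier_series c)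
      moreover have "integrable torus_measure (\<lambda>x. ?P x * torus_char (- j) x)"
        by (intro torus_integrable_continuous(1) continuous_intros)
      ultimately show ?thesis by (simp add: left_diff_distrib)
    qed
    ultimately show ?thesis by simp
  qed
  then have "norm (?I - c j) \<le> 0 + e" if "e > 0" for e using that by simp
  then have "norm (?I - c j) \<le> 0" by (rule field_le_epsilon)
  then show ?thesis by simp
qed

text \<open>
  The function and the sum of its Fourier series are continuous and have the same coefficients.
  Only the real part of their difference is shown to vanish, which is enough since \<open>f\<close> is real.
\<close>

lemma fourier_inversion:
  fixes f :: "real^'n \<Rightarrow> real"
  assumes f: "torus_C 0 f" and c: "(\<lambda>k. freq_weight k * norm (fourier_coeff f k)) summable_on UNIV"
  shows "f x = Re (fourier_series (fourier_coeff f) x)"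
proof -
  let ?S = "fourier_series (fourier_coeff f)"
  have cf: "continuous_on UNIV (\<lambda>x. complex_of_real (f x))"
    using f by (auto intro: continuous_intros)
  have cS: "continuous_on UNIV ?S" by (rule continuous_fourier_series[OF c])
  have "Re (of_real (f x) - ?S x) = 0"
  proof (rule Re_zero_of_fourier_coeffs_zero)
    show "continuous_on UNIV (\<lambda>x. of_real (f x) - ?S x)" by (intro continuous_intros cf cS)
    show "periodic_fun (\<lambda>x. of_real (f x) - ?S x)"
      using f periodic_fourier_series[of "fourier_coeff f"] by (auto simp: periodic_fun_def)
    fix k :: "int^'n"
    have "(LINT x|torus_measure. (of_real (f x) - ?S x) * torus_char k x)
        = (LINT x|torus_measure. of_real (f x) * torus_char (- (- k)) x) - (LINT x|torus_measure. ?S x * torus_char (- (- k)) x)"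
      unfolding left_diff_distrib minus_minus
      by (intro Bochner_Integration.integral_diff torus_integrable_continuous(1) continuous_on_mult cf cS continuous_torus_char)
    also have "\<dots> = 0"
      unfolding fourier_coeff_eq[symmetric] fourier_coeff_of_series[OF c] by simp
    finally show "(LINT x|torus_measure. (of_real (f x) - ?S x) * torus_char k x) = 0" .
  qed
  then show ?thesis by simp
qed

section \<open>The Sobolev embedding\<close>

lemma summable_int_inverse_square: "(\<lambda>n::int. inverse (1 + (of_int n)\<^sup>2 :: real)) summable_on UNIV"
proof -
  let ?f = "\<lambda>n::int. inverse (1 + (of_int n)\<^sup>2 :: real)"
  have "summable (\<lambda>n. inverse (real n ^ 2))" by (rule inverse_power_summable) simp
  then have "summable (\<lambda>n. inverse (1 + (real n)\<^sup>2))"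
  proof (rule summable_comparison_test'[where N = 1])
    fix n :: nat assume "1 \<le> n"
    then show "norm (inverse (1 + (real n)\<^sup>2)) \<le> inverse (real n ^ 2)"
      by (simp add: le_imp_inverse_le)
  qed
  then have nat: "(\<lambda>n. inverse (1 + (real n)\<^sup>2)) summable_on UNIV"
    by (subst summable_on_UNIV_nonneg_real_iff) auto
  have 1: "?f summable_on (range int)"
    by (subst summable_on_reindex) (auto simp: o_def nat)
  have "?f summable_on (range (\<lambda>n. - int n))"
    by (subst summable_on_reindex) (auto simp: o_def nat inj_on_def)
  then have 2: "?f summable_on (range (\<lambda>n. - int n) - range int)"
    by (rule summable_on_subset) auto
  have "range int \<union> (range (\<lambda>n. - int n) - range int) = UNIV"
  proof (intro equalityI subsetI UNIV_I)
    fix n :: int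
    show "n \<in> range int \<union> (range (\<lambda>n. - int n) - range int)"
      by (cases n rule: int_cases2) auto
  qed
  with summable_on_Un_disjoint[OF 1 2] show ?thesis by auto
qed

lemma summable_lattice_product:
  "(\<lambda>k::int^'n. \<Prod>i\<in>UNIV. inverse (1 + (of_int (k $ i))\<^sup>2 :: real)) summable_on UNIV"
proof -
  let ?g = "\<lambda>n::int. inverse (1 + (of_int n)\<^sup>2 :: real)"
  have nn: "0 \<le> ?g n" for n by simp
  have "Infinite_Sum.abs_summable_on ?g UNIV"
    using summable_int_inverse_square nn by (simp only: real_norm_def abs_of_nonneg)
  then have "Infinite_Set_Sum.abs_summable_on ?g UNIV" by (simp only: abs_summable_equivalent)
  then have "Infinite_Set_Sum.abs_summable_on (\<lambda>g. \<Prod>i\<in>(UNIV::'n set). ?g (g i)) (PiE UNIV (\<lambda>_. UNIV))"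
    by (intro abs_summable_on_prod_PiE) auto
  then have "Infinite_Sum.abs_summable_on (\<lambda>g. \<Prod>i\<in>(UNIV::'n set). ?g (g i)) UNIV"
    by (simp only: abs_summable_equivalent PiE_UNIV_domain Pi_UNIV)
  then have "(\<lambda>g. \<Prod>i\<in>(UNIV::'n set). ?g (g i)) summable_on UNIV"
    by (rule abs_summable_summable)
  moreover have "bij_betw (($) :: int^'n \<Rightarrow> 'n \<Rightarrow> int) UNIV UNIV"
    by (rule bij_betw_byWitness[where f' = vec_lambda]) auto
  ultimately show ?thesis
    using summable_on_reindex_bij_betw[of "($) :: int^'n \<Rightarrow> 'n \<Rightarrow> int" UNIV UNIV "\<lambda>g. \<Prod>i\<in>UNIV. ?g (g i)"] by simp
qed

text \<open>
  Each factor \<open>1 + k\<^sub>i\<^sup>2\<close> is at most the weight, so the reciprocal of the product of all \<open>d\<close> factors dominates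
  the power \<open>- d\<close> of the weight.  This reduces summability over the lattice to one dimension.
\<close>

lemma freq_weight_powr_le:
  assumes "p \<le> - real CARD('n)"
  shows "freq_weight (k::int^'n) powr p \<le> (\<Prod>i\<in>UNIV. inverse (1 + (of_int (k $ i))\<^sup>2))"
proof -
  let ?w = "freq_weight k"
  have w: "1 \<le> ?w" by (rule freq_weight_ge_1)
  have "?w powr p \<le> ?w powr (- real CARD('n))"
    using w assms by (intro powr_mono) auto
  also have "\<dots> = (\<Prod>i\<in>(UNIV::'n set). inverse ?w)"
    using w by (simp add: powr_minus powr_realpow power_inverse)
  also have "\<dots> \<le> (\<Prod>i\<in>UNIV. inverse (1 + (of_int (k $ i))\<^sup>2))"
  proof (rule prod_mono)
    fix i
    have "(of_int (k $ i) :: real)\<^sup>2 \<le> (\<Sum>j\<in>UNIV. (of_int (k $ j))\<^sup>2)"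
      by (rule member_le_sum) auto
    then have "1 + (of_int (k $ i))\<^sup>2 \<le> ?w" by (simp add: freq_weight_def)
    moreover have "0 < 1 + (of_int (k $ i) :: real)\<^sup>2" by (simp add: add_pos_nonneg)
    ultimately show "0 \<le> inverse ?w \<and> inverse ?w \<le> inverse (1 + (of_int (k $ i))\<^sup>2)"
      using w by (auto intro: le_imp_inverse_le)
  qed
  finally show ?thesis .
qed

text \<open>
  With \<open>a = w\<^bsup>s/2\<^esup> \<bar>c\<^sub>k\<bar>\<close> and \<open>b = w\<^bsup>m+1-s/2\<^esup>\<close> the quantity to be summed is \<open>a b \<le> a\<^sup>2 + b\<^sup>2\<close>.  The sum of
  \<open>a\<^sup>2\<close> is the square of the Sobolev norm, and \<open>b\<^sup>2\<close> is summable because its exponent is at most \<open>- d\<close>.  The threshold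
  for \<open>s\<close> is far from optimal but leaves only elementary estimates.
\<close>

lemma sobolev_embedding:
  fixes f :: "real^'n \<Rightarrow> real"
  assumes f: "torus_C 0 f" "torus_sobolev s f" and s: "s \<ge> real CARD('n) + 2 * real (Suc m)"
  shows "torus_C m f"
proof -
  let ?c = "fourier_coeff f"
  have "(\<lambda>k. freq_weight k powr s * (norm (?c k))\<^sup>2) summable_on UNIV"
    using f(2) by (simp add: torus_sobolev_def freq_weight_def)
  moreover have "(\<lambda>k::int^'n. \<Prod>i\<in>UNIV. inverse (1 + (of_int (k $ i))\<^sup>2 :: real)) summable_on UNIV"
    by (rule summable_lattice_product)
  ultimately have "(\<lambda>k. freq_weight k powr s * (norm (?c k))\<^sup>2 + (\<Prod>i\<in>UNIV. inverse (1 + (of_int (k $ i))\<^sup>2)))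
      summable_on UNIV"
    by (rule summable_on_add)
  then have sum: "(\<lambda>k. freq_weight k ^ Suc m * norm (?c k)) summable_on UNIV"
  proof (rule summable_on_comparison_test)
    fix k :: "int^'n"
    let ?w = "freq_weight k"
    have w: "0 < ?w" using freq_weight_ge_1[of k] by simp
    define a where "a = ?w powr (s / 2) * norm (?c k)"
    define b where "b = ?w powr (real (Suc m) - s / 2)"
    have "?w ^ Suc m = ?w powr (s / 2) * b"
      using w by (simp add: b_def powr_add[symmetric] powr_realpow[symmetric] del: of_nat_Suc power_Suc)
    then have "?w ^ Suc m * norm (?c k) = a * b" by (simp add: a_def)
    also have "\<dots> \<le> a\<^sup>2 + b\<^sup>2"
    proof -
      have "0 \<le> (a - b)\<^sup>2 + a\<^sup>2 + b\<^sup>2" by simp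
      then show ?thesis by (simp add: power2_diff)
    qed
    also have "a\<^sup>2 = ?w powr s * (norm (?c k))\<^sup>2"
      using w by (simp add: a_def power_mult_distrib power2_eq_square powr_add[symmetric] mult_ac)
    also have "b\<^sup>2 = ?w powr (2 * real (Suc m) - s)"
      using w by (simp add: b_def power2_eq_square powr_add[symmetric] algebra_simps)
    also have "\<dots> \<le> (\<Prod>i\<in>UNIV. inverse (1 + (of_int (k $ i))\<^sup>2))"
      using s by (intro freq_weight_powr_le) simp
    finally show "?w ^ Suc m * norm (?c k)
        \<le> ?w powr s * (norm (?c k))\<^sup>2 + (\<Prod>i\<in>UNIV. inverse (1 + (of_int (k $ i))\<^sup>2))"
      by simp
    show "0 \<le> ?w ^ Suc m * norm (?c k)" using w by simp
  qed
  have "f = (\<lambda>x. Re (fourier_series ?c x))"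
    using fourier_inversion[OF f(1)] summable_weight_mono[OF sum, of 1] by auto
  then show ?thesis
    using torus_C_Re[OF torus_C_fourier_series[OF sum]] by simp
qed


section \<open>The modulated energy of the prepared data\<close>

lemma norm_vec_lambda_sq:
  "(norm (\<chi> i. (z i :: 'b::real_normed_vector)))\<^sup>2 = (\<Sum>i\<in>(UNIV::'n::finite set). (norm (z i))\<^sup>2)"
  by (simp add: norm_vec_def L2_set_def sum_nonneg)

lemma norm_phase: "cmod (exp (\<i> * of_real t / of_real h)) = 1"
proof -
  have "\<i> * of_real t / of_real h = \<i> * complex_of_real (t / h)" by simp
  then show ?thesis by (metis norm_exp_i_times)
qed

text \<open>
  Write \<open>\<psi> = \<surd>f exp (\<i> U / hbar)\<close>.  Differentiating the phase produces \<open>- u \<psi>\<close> in \<open>\<i> hbar \<nabla>\<psi>\<close>, which the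
  velocity term cancels; what remains is \<open>hbar\<close> times the gradient of the amplitude.
\<close>

lemma kinetic_density_psi_in:
  fixes V\<^sub>0 U\<^sub>0 :: "real^'n \<Rightarrow> real"
  assumes f: "torus_C 1 f" "f = (\<lambda>x. exp (V\<^sub>0 x) - \<epsilon> * laplacian V\<^sub>0 x)"
    and pos: "\<And>x. f x > 0" and U: "torus_C 1 U\<^sub>0" and "hbar > 0"
  shows "(norm (\<chi> i. \<i> * of_real hbar * pderiv_dir i (psi_in \<epsilon> hbar V\<^sub>0 U\<^sub>0) x
             + of_real (grad U\<^sub>0 x $ i) * psi_in \<epsilon> hbar V\<^sub>0 U\<^sub>0 x))\<^sup>2
         = hbar\<^sup>2 * (\<Sum>i\<in>UNIV. (pderiv_dir i f x)\<^sup>2 / (4 * f x))"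
proof -
  have f': "torus_C (Suc 0) f" and U': "torus_C (Suc 0) U\<^sub>0" using f U by auto
  let ?E = "\<lambda>x. exp (\<i> * of_real (U\<^sub>0 x) / of_real hbar)"
  have psi: "psi_in \<epsilon> hbar V\<^sub>0 U\<^sub>0 = (\<lambda>x. of_real (sqrt (f x)) * ?E x)"
    by (simp add: psi_in_def[abs_def] f(2))
  have E: "cmod (?E x) = 1" by (rule norm_phase)
  have "(cmod (\<i> * of_real hbar * pderiv_dir i (psi_in \<epsilon> hbar V\<^sub>0 U\<^sub>0) x
             + of_real (grad U\<^sub>0 x $ i) * psi_in \<epsilon> hbar V\<^sub>0 U\<^sub>0 x))\<^sup>2
         = hbar\<^sup>2 * ((pderiv_dir i f x)\<^sup>2 / (4 * f x))" for i
  proof -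
    let ?e = "axis i 1 :: real^'n"
    define r where "r = pderiv_dir i f x / (2 * sqrt (f x))"
    define p where "p = pderiv_dir i U\<^sub>0 x"
    have "((\<lambda>t. sqrt (f (x + t *\<^sub>R ?e))) has_real_derivative r) (at 0)"
      by (rule DERIV_cong[OF DERIV_chain2[OF DERIV_real_sqrt torus_C_has_pderiv_real[OF f']]])
        (use pos in \<open>simp_all add: r_def field_simps\<close>)
    then have 1: "((\<lambda>t. complex_of_real (sqrt (f (x + t *\<^sub>R ?e)))) has_vector_derivative of_real r) (at 0)"
      by (rule has_vector_derivative_of_real)
    have "((\<lambda>t. complex_of_real (U\<^sub>0 (x + t *\<^sub>R ?e))) has_vector_derivative of_real p) (at 0)"
      unfolding p_def by (rule has_vector_derivative_of_real[OF torus_C_has_pderiv_real[OF U']])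
    then have "((\<lambda>t. \<i> / of_real hbar * complex_of_real (U\<^sub>0 (x + t *\<^sub>R ?e))) has_vector_derivative
        \<i> / of_real hbar * of_real p) (at 0)"
      by (rule has_vector_derivative_mult_right)
    then have "((\<lambda>t. \<i> * complex_of_real (U\<^sub>0 (x + t *\<^sub>R ?e)) / of_real hbar) has_vector_derivative
        \<i> / of_real hbar * of_real p) (at 0)"
      by simp
    from field_vector_diff_chain_at[OF this DERIV_exp]
    have 2: "((\<lambda>t. ?E (x + t *\<^sub>R ?e)) has_vector_derivative
        (\<i> / of_real hbar * of_real p) * ?E x) (at 0)"
      by (simp add: o_def)
    have "pderiv_dir i (psi_in \<epsilon> hbar V\<^sub>0 U\<^sub>0) x
        = of_real (sqrt (f x)) * ((\<i> / of_real hbar * of_real p) * ?E x) + of_real r * ?E x"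
      unfolding psi by (rule pderiv_dirI) (use has_vector_derivative_mult[OF 1 2] in simp)
    \<comment> \<open>the phase of \<open>\<psi>\<close> is chosen so that the velocity term cancels\<close>
    then have "\<i> * of_real hbar * pderiv_dir i (psi_in \<epsilon> hbar V\<^sub>0 U\<^sub>0) x
             + of_real (grad U\<^sub>0 x $ i) * psi_in \<epsilon> hbar V\<^sub>0 U\<^sub>0 x = \<i> * of_real (hbar * r) * ?E x"
      using \<open>hbar > 0\<close> by (simp add: psi grad_def p_def field_simps)
    then have "(cmod (\<i> * of_real hbar * pderiv_dir i (psi_in \<epsilon> hbar V\<^sub>0 U\<^sub>0) x
             + of_real (grad U\<^sub>0 x $ i) * psi_in \<epsilon> hbar V\<^sub>0 U\<^sub>0 x))\<^sup>2 = hbar\<^sup>2 * r\<^sup>2"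
      by (simp only: norm_mult E norm_ii norm_of_real) (simp add: power_mult_distrib)
    also have "r\<^sup>2 = (pderiv_dir i f x)\<^sup>2 / (4 * f x)"
      using pos[of x] by (simp add: r_def power_divide power_mult_distrib)
    finally show ?thesis .
  qed
  then show ?thesis
    by (simp add: norm_vec_lambda_sq sum_distrib_left)
qed

text \<open>
  The density \<open>\<bar>\<psi>\<bar>\<^sup>2 = exp V\<^sub>0 - \<epsilon> \<Delta>V\<^sub>0\<close> is chosen so that \<open>V\<^sub>0\<close> solves the equation.
\<close>

lemma PB_potential_psi_in:
  assumes "torus_C 2 V\<^sub>0" "\<epsilon> > 0" "\<And>x. exp (V\<^sub>0 x) - \<epsilon> * laplacian V\<^sub>0 x > 0"
  shows "PB_potential \<epsilon> (psi_in \<epsilon> hbar V\<^sub>0 U\<^sub>0) = V\<^sub>0"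
proof (rule PB_potential_eq)
  show "PB_solution \<epsilon> (psi_in \<epsilon> hbar V\<^sub>0 U\<^sub>0) V\<^sub>0"
    unfolding PB_solution_def
  proof (intro conjI allI)
    fix x
    have "(cmod (psi_in \<epsilon> hbar V\<^sub>0 U\<^sub>0 x))\<^sup>2 = (sqrt (exp (V\<^sub>0 x) - \<epsilon> * laplacian V\<^sub>0 x))\<^sup>2"
      by (simp only: psi_in_def norm_mult norm_phase norm_of_real power2_abs mult_1_right)
    also have "\<dots> = exp (V\<^sub>0 x) - \<epsilon> * laplacian V\<^sub>0 x"
      using assms(3)[of x] by simp
    finally show "- \<epsilon> * laplacian V\<^sub>0 x = (cmod (psi_in \<epsilon> hbar V\<^sub>0 U\<^sub>0 x))\<^sup>2 - exp (V\<^sub>0 x)"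
      by simp
  qed fact
qed fact

text \<open>
  Since the potential is \<open>V\<^sub>0 = ln \<rho>\<^sub>0\<close>, the density \<open>m\<close> is \<open>\<rho>\<^sub>0\<close> and the relative entropy vanishes identically.
\<close>

lemma modulated_energy_psi_in:
  fixes V\<^sub>0 U\<^sub>0 :: "real^'n \<Rightarrow> real"
  assumes f: "torus_C 1 f" "f = (\<lambda>x. exp (V\<^sub>0 x) - \<epsilon> * laplacian V\<^sub>0 x)"
    and pos: "\<And>x. f x > 0" and V: "torus_C 2 V\<^sub>0" and U: "torus_C 1 U\<^sub>0" and "hbar > 0" "\<epsilon> > 0"
    and rho: "\<And>x. \<rho>\<^sub>0 x = exp (V\<^sub>0 x)"
  shows "modulated_energy \<epsilon> hbar (psi_in \<epsilon> hbar V\<^sub>0 U\<^sub>0) \<rho>\<^sub>0 (grad U\<^sub>0) =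
     1 / 2 * (LINT x|torus_measure. hbar\<^sup>2 * (\<Sum>i\<in>UNIV. (pderiv_dir i f x)\<^sup>2 / (4 * f x)))
     + \<epsilon> / 2 * (LINT x|torus_measure. (norm (grad V\<^sub>0 x))\<^sup>2)"
proof -
  have "PB_potential \<epsilon> (psi_in \<epsilon> hbar V\<^sub>0 U\<^sub>0) = V\<^sub>0"
    using V \<open>\<epsilon> > 0\<close> pos f(2) by (intro PB_potential_psi_in) auto
  then show ?thesis
    by (simp add: modulated_energy_def Let_def rho
        kinetic_density_psi_in[OF f pos U \<open>hbar > 0\<close>])
qed

text \<open>
  For small \<open>\<epsilon>\<close> the amplitude squared \<open>f = \<rho>\<^sub>0 - \<epsilon> \<Delta>V\<^sub>0\<close> is at least \<open>c / 2\<close>, where \<open>c > 0\<close> is a lower bound of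
  \<open>\<rho>\<^sub>0\<close>, and \<open>\<nabla>f\<close> is bounded uniformly in \<open>\<epsilon>\<close>; the bound on \<open>\<nabla>\<Delta>V\<^sub>0\<close> is where three derivatives of \<open>V\<^sub>0\<close>
  are used.  So the kinetic term is \<open>O(hbar\<^sup>2)\<close> and the electric term is \<open>O(\<epsilon>)\<close>.
\<close>

lemma modulated_energy_bound:
  fixes V\<^sub>0 U\<^sub>0 :: "real^'n \<Rightarrow> real"
  assumes rho: "torus_C 1 \<rho>\<^sub>0" "\<And>x. \<rho>\<^sub>0 x = exp (V\<^sub>0 x)"
    and V: "torus_C 3 V\<^sub>0" and U: "torus_C 1 U\<^sub>0"
  obtains \<delta> K where "\<delta> > 0" "K \<ge> 0"
    "\<And>\<epsilon> x. 0 < \<epsilon> \<Longrightarrow> \<epsilon> < \<delta> \<Longrightarrow> exp (V\<^sub>0 x) - \<epsilon> * laplacian V\<^sub>0 x > 0"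
    "\<And>\<epsilon> hbar. 0 < \<epsilon> \<Longrightarrow> \<epsilon> < \<delta> \<Longrightarrow> 0 < hbar \<Longrightarrow>
       \<bar>modulated_energy \<epsilon> hbar (psi_in \<epsilon> hbar V\<^sub>0 U\<^sub>0) \<rho>\<^sub>0 (grad U\<^sub>0)\<bar> \<le> K * (hbar\<^sup>2 + \<epsilon>)"
proof -
  let ?L = "laplacian V\<^sub>0"
  have V3: "torus_C (Suc (Suc 1)) V\<^sub>0" and V2: "torus_C 2 V\<^sub>0"
    using torus_C_mono[OF V] by (auto simp: numeral_3_eq_3 numeral_2_eq_2 simp del: torus_C.simps)
  have L: "torus_C 1 ?L" by (rule torus_C_laplacian[OF V3])
  have rho': "torus_C (Suc 0) \<rho>\<^sub>0" and L': "torus_C (Suc 0) ?L" using rho L by simp_all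
  obtain M where M: "\<And>x. norm (inverse (\<rho>\<^sub>0 x)) \<le> M" "M > 0"
    using periodic_bounded[of "\<lambda>x. inverse (\<rho>\<^sub>0 x)"] torus_C_inverse[OF rho(1)] rho(2)
      torus_C_periodic torus_C_continuous by (metis exp_not_eq_zero)
  define c where "c = 1 / M"
  have c: "c > 0" "c \<le> \<rho>\<^sub>0 x" for x
    using M(1)[of x] M(2) rho(2)[of x] by (auto simp: c_def field_simps)
  obtain B where B: "\<And>x. norm (?L x) \<le> B" "B > 0"
    using periodic_bounded[OF torus_C_periodic[OF L] torus_C_continuous[OF L]] by blast
  have "\<exists>G. \<forall>x. norm (h x) \<le> G" if "torus_C 0 h" for h :: "real^'n \<Rightarrow> real"
    using periodic_bounded[OF torus_C_periodic[OF that] torus_C_continuous[OF that]] by metis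
  then have "\<forall>i. \<exists>G. \<forall>x. norm (h i x) \<le> G" if "\<And>i. torus_C 0 (h i)" for h :: "'n \<Rightarrow> real^'n \<Rightarrow> real"
    using that by blast
  note bd = this[THEN choice]
  obtain Gr where Gr: "\<And>i x. norm (pderiv_dir i \<rho>\<^sub>0 x) \<le> Gr i"
    using bd[of "\<lambda>i. pderiv_dir i \<rho>\<^sub>0"] torus_C_pderiv[OF rho'] by blast
  obtain GL where GL: "\<And>i x. norm (pderiv_dir i ?L x) \<le> GL i"
    using bd[of "\<lambda>i. pderiv_dir i ?L"] torus_C_pderiv[OF L'] by blast
  have "torus_C 0 (pderiv_dir i V\<^sub>0)" for i
    using torus_C_pderiv[OF V3] by (rule torus_C_mono) simp
  then obtain GV where GV: "\<And>i x. norm (pderiv_dir i V\<^sub>0 x) \<le> GV i"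
    using bd[of "\<lambda>i. pderiv_dir i V\<^sub>0"] by blast
  \<comment> \<open>the bound \<open>c / (2 * B)\<close> keeps \<open>f\<close> above \<open>c / 2\<close>; the bound 1 absorbs the factor \<open>\<epsilon>\<close> in \<open>\<nabla>f\<close>\<close>
  define \<delta> where "\<delta> = min 1 (c / (2 * B))"
  have d: "\<delta> > 0" using c B(2) by (simp add: \<delta>_def)
  define K1 where "K1 = (\<Sum>i\<in>(UNIV::'n set). (Gr i + GL i)\<^sup>2 / (2 * c))"
  define K2 where "K2 = (\<Sum>i\<in>(UNIV::'n set). (GV i)\<^sup>2)"
  have K: "K1 \<ge> 0" "K2 \<ge> 0" using c by (auto simp: K1_def K2_def intro!: sum_nonneg)
  have low: "exp (V\<^sub>0 x) - \<epsilon> * ?L x \<ge> c / 2" if "0 < \<epsilon>" "\<epsilon> < \<delta>" for \<epsilon> x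
  proof -
    have "\<epsilon> * ?L x \<le> \<epsilon> * B" using B(1)[of x] that by (intro mult_left_mono) auto
    also have "\<dots> \<le> c / (2 * B) * B" using that B(2) by (intro mult_right_mono) (auto simp: \<delta>_def)
    also have "\<dots> = c / 2" using B(2) by simp
    finally show ?thesis using c(2)[of x] rho(2)[of x] by simp
  qed
  show ?thesis
  proof (rule that[of \<delta> "K1 + K2"])
    show "exp (V\<^sub>0 x) - \<epsilon> * ?L x > 0" if "0 < \<epsilon>" "\<epsilon> < \<delta>" for \<epsilon> x
      using low[OF that, of x] c(1) by linarith
    fix \<epsilon> hbar :: real assume e: "0 < \<epsilon>" "\<epsilon> < \<delta>" and h: "0 < hbar"
    define f where "f = (\<lambda>x. exp (V\<^sub>0 x) - \<epsilon> * ?L x)"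
    have f_low: "f x \<ge> c / 2" for x using low[OF e] by (simp add: f_def)
    then have f_pos: "f x > 0" for x using c(1) by (meson half_gt_zero less_le_trans)
    have "torus_C 1 (\<lambda>x. \<rho>\<^sub>0 x + (- \<epsilon>) * ?L x)"
      by (intro torus_C_add torus_C_mult torus_C_const rho L)
    then have f: "torus_C 1 f" by (simp add: f_def rho(2))
    have f': "pderiv_dir i f x = pderiv_dir i \<rho>\<^sub>0 x - \<epsilon> * pderiv_dir i ?L x" for i x
      unfolding f_def rho(2)[symmetric]
      by (rule pderiv_dirI, unfold has_real_derivative_iff_has_vector_derivative[symmetric])
        (intro DERIV_diff DERIV_cmult torus_C_has_pderiv_real[OF rho'] torus_C_has_pderiv_real[OF L'])
    have "norm (hbar\<^sup>2 * (\<Sum>i\<in>UNIV. (pderiv_dir i f x)\<^sup>2 / (4 * f x))) \<le> hbar\<^sup>2 * K1" for x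
    proof -
      have "(pderiv_dir i f x)\<^sup>2 / (4 * f x) \<le> (Gr i + GL i)\<^sup>2 / (2 * c)" for i
      proof (rule frac_le)
        have "\<bar>pderiv_dir i f x\<bar> \<le> \<bar>pderiv_dir i \<rho>\<^sub>0 x\<bar> + \<epsilon> * \<bar>pderiv_dir i ?L x\<bar>"
          using e by (simp add: f' abs_mult order_trans[OF abs_triangle_ineq4])
        also have "\<epsilon> * \<bar>pderiv_dir i ?L x\<bar> \<le> 1 * \<bar>pderiv_dir i ?L x\<bar>"
          using e by (intro mult_right_mono) (auto simp: \<delta>_def)
        finally have "\<bar>pderiv_dir i f x\<bar> \<le> Gr i + GL i" using Gr[of i x] GL[of i x] by simp
        then show "(pderiv_dir i f x)\<^sup>2 \<le> (Gr i + GL i)\<^sup>2"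
          by (metis abs_ge_zero power2_abs power_mono)
        show "2 * c \<le> 4 * f x" using f_low[of x] by simp
      qed (use c in auto)
      then have "(\<Sum>i\<in>UNIV. (pderiv_dir i f x)\<^sup>2 / (4 * f x)) \<le> K1"
        unfolding K1_def by (rule sum_mono)
      moreover have "(\<Sum>i\<in>UNIV. (pderiv_dir i f x)\<^sup>2 / (4 * f x)) \<ge> 0"
        using f_pos[of x] by (intro sum_nonneg) auto
      ultimately show ?thesis by (simp add: mult_left_mono)
    qed
    then have 1: "norm (LINT x|torus_measure. hbar\<^sup>2 * (\<Sum>i\<in>UNIV. (pderiv_dir i f x)\<^sup>2 / (4 * f x))) \<le> hbar\<^sup>2 * K1"
      by (rule torus_integral_norm_le)
    have "norm ((norm (grad V\<^sub>0 x))\<^sup>2) \<le> K2" for x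
    proof -
      have "\<bar>pderiv_dir i V\<^sub>0 x\<bar>\<^sup>2 \<le> (GV i)\<^sup>2" for i using GV[of i x] by (intro power_mono) auto
      then have "(\<Sum>i\<in>UNIV. (norm (pderiv_dir i V\<^sub>0 x))\<^sup>2) \<le> K2"
        unfolding K2_def by (intro sum_mono) simp
      then show ?thesis
        by (simp only: grad_def norm_vec_lambda_sq real_norm_def abs_of_nonneg[OF sum_nonneg] zero_le_power2)
    qed
    then have 2: "norm (LINT x|torus_measure. (norm (grad V\<^sub>0 x))\<^sup>2) \<le> K2"
      by (rule torus_integral_norm_le)
    let ?I = "LINT x|torus_measure. hbar\<^sup>2 * (\<Sum>i\<in>UNIV. (pderiv_dir i f x)\<^sup>2 / (4 * f x))"
    let ?J = "LINT x|torus_measure. (norm (grad V\<^sub>0 x))\<^sup>2"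
    have "\<bar>1 / 2 * ?I + \<epsilon> / 2 * ?J\<bar> \<le> \<bar>?I\<bar> + \<epsilon> * \<bar>?J\<bar>"
      using e by (intro order_trans[OF abs_triangle_ineq] add_mono) (auto simp: abs_mult)
    also have "\<dots> \<le> hbar\<^sup>2 * K1 + \<epsilon> * K2"
      using 1 2 e by (intro add_mono mult_left_mono) auto
    also have "\<dots> \<le> (K1 + K2) * (hbar\<^sup>2 + \<epsilon>)"
      using K e by (simp add: algebra_simps)
    finally show "\<bar>modulated_energy \<epsilon> hbar (psi_in \<epsilon> hbar V\<^sub>0 U\<^sub>0) \<rho>\<^sub>0 (grad U\<^sub>0)\<bar> \<le> (K1 + K2) * (hbar\<^sup>2 + \<epsilon>)"
      using modulated_energy_psi_in[OF f f_def f_pos V2 U h e(1) rho(2)] by simp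
  qed (use d K in auto)
qed

theorem lemma4p1:
  "\<exists>s\<^sub>0>1. \<forall>s>s\<^sub>0. \<forall>(\<rho>\<^sub>0 :: real^'n \<Rightarrow> real) (u\<^sub>0 :: real^'n \<Rightarrow> real^'n) (U\<^sub>0 :: real^'n \<Rightarrow> real) V\<^sub>0.
     torus_C 0 \<rho>\<^sub>0 \<longrightarrow> torus_sobolev s \<rho>\<^sub>0 \<longrightarrow> torus_prob_density \<rho>\<^sub>0 \<longrightarrow> (\<forall>x. \<rho>\<^sub>0 x > 0) \<longrightarrow>
     torus_C 1 U\<^sub>0 \<longrightarrow> u\<^sub>0 = grad U\<^sub>0 \<longrightarrow> (\<forall>i. torus_sobolev s (\<lambda>x. u\<^sub>0 x $ i)) \<longrightarrow>
     V\<^sub>0 = (\<lambda>x. ln (\<rho>\<^sub>0 x)) \<longrightarrow>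
     (\<forall>\<^sub>F \<epsilon> in at_right 0. \<forall>x. exp (V\<^sub>0 x) - \<epsilon> * laplacian V\<^sub>0 x > 0) \<and>
     ((\<lambda>(\<epsilon>, hbar). modulated_energy \<epsilon> hbar (psi_in \<epsilon> hbar V\<^sub>0 U\<^sub>0) \<rho>\<^sub>0 u\<^sub>0) \<longlongrightarrow> 0)
       (inf (filtercomap (\<lambda>(\<epsilon>, hbar). \<epsilon> + hbar) (nhds 0))
            (principal {(\<epsilon>, hbar). \<epsilon> > 0 \<and> hbar > 0 \<and>
                          (\<forall>x. exp (V\<^sub>0 x) - \<epsilon> * laplacian V\<^sub>0 x > 0)}))"
\<comment> \<open>\<open>8 = 2 (m + 1)\<close> for the order \<open>m = 3\<close> of smoothness that the energy estimate requires\<close>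
proof (intro exI[of _ "real CARD('n) + 8"] conjI allI impI)
  show "1 < real CARD('n) + 8" by simp
  fix s and \<rho>\<^sub>0 :: "real^'n \<Rightarrow> real" and u\<^sub>0 :: "real^'n \<Rightarrow> real^'n" and U\<^sub>0 V\<^sub>0 :: "real^'n \<Rightarrow> real"
  assume s: "real CARD('n) + 8 < s" and rho: "torus_C 0 \<rho>\<^sub>0" "torus_sobolev s \<rho>\<^sub>0" and pos: "\<forall>x. \<rho>\<^sub>0 x > 0"
    and U: "torus_C 1 U\<^sub>0" and u: "u\<^sub>0 = grad U\<^sub>0" and V: "V\<^sub>0 = (\<lambda>x. ln (\<rho>\<^sub>0 x))"
  have rho3: "torus_C 3 \<rho>\<^sub>0" using s by (intro sobolev_embedding[OF rho]) simp
  have V3: "torus_C 3 V\<^sub>0" unfolding V using pos by (intro torus_C_ln rho3) simp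
  have rho1: "torus_C 1 \<rho>\<^sub>0" using rho3 by (rule torus_C_mono) simp
  have rhoV: "\<rho>\<^sub>0 x = exp (V\<^sub>0 x)" for x using pos by (simp add: V)
  obtain \<delta> K where d: "\<delta> > 0" and K: "K \<ge> 0"
    and dpos: "\<And>\<epsilon> x. 0 < \<epsilon> \<Longrightarrow> \<epsilon> < \<delta> \<Longrightarrow> exp (V\<^sub>0 x) - \<epsilon> * laplacian V\<^sub>0 x > 0"
    and bound: "\<And>\<epsilon> hbar. 0 < \<epsilon> \<Longrightarrow> \<epsilon> < \<delta> \<Longrightarrow> 0 < hbar \<Longrightarrow>
       \<bar>modulated_energy \<epsilon> hbar (psi_in \<epsilon> hbar V\<^sub>0 U\<^sub>0) \<rho>\<^sub>0 (grad U\<^sub>0)\<bar> \<le> K * (hbar\<^sup>2 + \<epsilon>)"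
    by (rule modulated_energy_bound[OF rho1 rhoV V3 U]) blast
  show "\<forall>\<^sub>F \<epsilon> in at_right 0. \<forall>x. exp (V\<^sub>0 x) - \<epsilon> * laplacian V\<^sub>0 x > 0"
    using d dpos by (auto simp: eventually_at_right_field)
  let ?S = "{(\<epsilon>, hbar). \<epsilon> > 0 \<and> hbar > 0 \<and> (\<forall>x. exp (V\<^sub>0 x) - \<epsilon> * laplacian V\<^sub>0 x > 0)}"
  let ?E = "\<lambda>(\<epsilon>, hbar). modulated_energy \<epsilon> hbar (psi_in \<epsilon> hbar V\<^sub>0 U\<^sub>0) \<rho>\<^sub>0 u\<^sub>0"
  show "(?E \<longlongrightarrow> 0) (inf (filtercomap (\<lambda>(\<epsilon>, hbar). \<epsilon> + hbar) (nhds 0)) (principal ?S))"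
  proof (rule tendstoI)
    fix e :: real assume e: "e > 0"
    \<comment> \<open>below 1, \<open>hbar\<^sup>2\<close> is at most \<open>hbar\<close>; the summand in \<open>K + 1\<close> avoids division by 0\<close>
    define \<eta> where "\<eta> = min \<delta> (min 1 (e / (K + 1)))"
    have eta: "\<eta> > 0" using d e K by (simp add: \<eta>_def)
    have small: "dist (?E (\<epsilon>, hbar)) 0 < e" if "(\<epsilon>, hbar) \<in> ?S" "\<bar>\<epsilon> + hbar\<bar> < \<eta>" for \<epsilon> hbar
    proof -
      have p: "0 < \<epsilon>" "0 < hbar" and t: "\<epsilon> < \<delta>" "hbar < 1" "\<epsilon> + hbar < e / (K + 1)"
        using that by (auto simp: \<eta>_def)
      have "\<bar>?E (\<epsilon>, hbar)\<bar> \<le> K * (hbar\<^sup>2 + \<epsilon>)"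
        using bound[OF p(1) t(1) p(2)] by (simp add: u)
      also have "\<dots> \<le> (K + 1) * (\<epsilon> + hbar)"
      proof (rule mult_mono)
        show "hbar\<^sup>2 + \<epsilon> \<le> \<epsilon> + hbar"
          using p t mult_right_mono[of hbar 1 hbar] by (simp add: power2_eq_square)
      qed (use p K in auto)
      also have "\<dots> < e" using t(3) K by (simp add: field_simps)
      finally show ?thesis by simp
    qed
    have "eventually (\<lambda>r. \<bar>r\<bar> < \<eta>) (nhds (0::real))"
      using eta by (auto simp: eventually_nhds_metric dist_real_def)
    then show "\<forall>\<^sub>F p in inf (filtercomap (\<lambda>(\<epsilon>, hbar). \<epsilon> + hbar) (nhds 0)) (principal ?S). dist (?E p) 0 < e"
      unfolding eventually_inf_principal eventually_filtercomap
    proof (intro exI[of _ "\<lambda>r. \<bar>r\<bar> < \<eta>"] conjI allI impI)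
      fix p :: "real \<times> real"
      assume p: "\<bar>case p of (\<epsilon>, hbar) \<Rightarrow> \<epsilon> + hbar\<bar> < \<eta>" "p \<in> ?S"
      obtain \<epsilon> hbar where [simp]: "p = (\<epsilon>, hbar)" by (cases p)
      show "dist (?E p) 0 < e" using small[of \<epsilon> hbar] p by simp
    qed
  qed
qed

end
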